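(* Let $\mathbf{c}=(c_1,\ldots,c_n)$ be an integral sequence and let $1\le k\le n$. Then the fan $\Sigma(k)$ in $\mathbb{R}^k$ determined by the first $k$ terms $(c_1,\ldots,c_k)$ of $\mathbf{c}$ is smooth and projective.
   Context: An integral sequence $\mathbf{c}=(c_1,\ldots,c_n)$ is given by arbitrary integers $c(i,j)$, $1\le i<j\le n$, with $c(i,i):=1$ and $c_k=(c(1,k),\ldots,c(k,k))\in\mathbb{Z}^k$. Let $\mathcal{C}(n)$ be the upper triangular $n\times n$ matrix with $(i,j)$ entry $c(i,j)$ for $i\le j$ and $0$ otherwise. The Bott matrix $\mathcal{B}(n)=(b(i,j))$ is defined by $\mathcal{C}(n)^{-1}=-\mathcal{B}(n)$; thus $b(i,i)=-1$, $b(i,j)=0$ for $i>j$, and $b(i,j)=-\sum_{i<k\le j}c(i,k)b(k,j)$ for $i<j$. $\Sigma(k)$ is the fan in $\mathbb{R}^k$ (lattice $\mathbb{Z}^k$) whose rays are generated by $a_{i,0}:=e_i$ and $a_{i,1}:=(0,\ldots,0,b(i,i),b(i,i+1),\ldots,b(i,k))$, $1\le i\le k$, and whose $k$-dimensional cones are $\sigma(w):=\mathbb{R}_{\ge}a_{1,w_1}+\cdots+\mathbb{R}_{\ge}a_{k,w_k}$ for $w=w_1\cdots w_k\in\{0,1\}^k$ (the other cones are the faces of these). A fan is smooth if each of its cones is generated by part of a lattice basis, and projective if its associated toric variety is projective. *)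

theory Defs
  imports
    "HOL-Analysis.Abstract_Topology"
    "HOL-Library.FuncSet"
    "Jordan_Normal_Form.Determinant"
begin

text \<open>
  Vectors of \<open>\<real>\<^sup>k\<close> and of the lattice \<open>\<int>\<^sup>k\<close> are elements of \<^term>\<open>carrier_vec k\<close>, with
  coordinates numbered \<open>0, \<dots>, k - 1\<close>. Accordingly all indices of the mathematical
  source are shifted down by one: \<open>c i j\<close> stands for \<open>c(i+1, j+1)\<close>. The dual lattice is
  identified with \<open>\<int>\<^sup>k\<close> through the scalar product.
\<close>

section \<open>Cones and fans\<close>

definition cone_hull :: "nat \<Rightarrow> int vec set \<Rightarrow> real vec set" where
  "cone_hull k A = {u \<in> carrier_vec k. \<exists>l. (\<forall>a\<in>A. 0 \<le> l a) \<and>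
     (\<forall>i<k. u $ i = (\<Sum>a\<in>A. l a * real_of_int (a $ i)))}"

definition rational_cone :: "nat \<Rightarrow> real vec set \<Rightarrow> bool" where
  "rational_cone k \<sigma> \<longleftrightarrow> (\<exists>A. finite A \<and> A \<subseteq> carrier_vec k \<and> \<sigma> = cone_hull k A)"

definition strongly_convex :: "nat \<Rightarrow> real vec set \<Rightarrow> bool" where
  "strongly_convex k \<sigma> \<longleftrightarrow> \<sigma> \<inter> uminus ` \<sigma> = {0\<^sub>v k}"

definition cone_face :: "nat \<Rightarrow> real vec set \<Rightarrow> real vec set \<Rightarrow> bool" where
  "cone_face k \<tau> \<sigma> \<longleftrightarrow>
     (\<exists>m\<in>carrier_vec k. (\<forall>u\<in>\<sigma>. 0 \<le> m \<bullet> u) \<and> \<tau> = {u\<in>\<sigma>. m \<bullet> u = 0})"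

definition fan :: "nat \<Rightarrow> real vec set set \<Rightarrow> bool" where
  "fan k \<Sigma> \<longleftrightarrow> finite \<Sigma> \<and>
     (\<forall>\<sigma>\<in>\<Sigma>. rational_cone k \<sigma> \<and> strongly_convex k \<sigma>) \<and>
     (\<forall>\<sigma>\<in>\<Sigma>. \<forall>\<tau>. cone_face k \<tau> \<sigma> \<longrightarrow> \<tau> \<in> \<Sigma>) \<and>
     (\<forall>\<sigma>\<in>\<Sigma>. \<forall>\<sigma>'\<in>\<Sigma>. cone_face k (\<sigma> \<inter> \<sigma>') \<sigma> \<and> cone_face k (\<sigma> \<inter> \<sigma>') \<sigma>')"

text \<open>Coefficient families are taken extensional on \<open>B\<close>, so that uniqueness is meaningful.\<close>

definition lattice_basis :: "nat \<Rightarrow> int vec set \<Rightarrow> bool" where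
  "lattice_basis k B \<longleftrightarrow> finite B \<and> B \<subseteq> carrier_vec k \<and>
     (\<forall>v\<in>carrier_vec k. \<exists>!l. l \<in> extensional B \<and> (\<forall>i<k. v $ i = (\<Sum>b\<in>B. l b * b $ i)))"

definition smooth_fan :: "nat \<Rightarrow> real vec set set \<Rightarrow> bool" where
  "smooth_fan k \<Sigma> \<longleftrightarrow>
     (\<forall>\<sigma>\<in>\<Sigma>. \<exists>B A. lattice_basis k B \<and> A \<subseteq> B \<and> \<sigma> = cone_hull k A)"


section \<open>Varieties as spaces with complex-valued functions\<close>

text \<open>
  \<^term>\<open>regular X U f\<close> says that \<open>f\<close> is a section over \<open>U\<close> of the sheaf of regular functions;
  only the values of \<open>f\<close> on \<open>U\<close> matter.
\<close>

record 'a fun_space =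
  zariski :: "'a topology"
  regular :: "'a set \<Rightarrow> ('a \<Rightarrow> complex) \<Rightarrow> bool"

definition sheaf_of :: "'a topology \<Rightarrow> ('a set \<Rightarrow> ('a \<Rightarrow> complex) \<Rightarrow> bool) \<Rightarrow>
    'a set \<Rightarrow> ('a \<Rightarrow> complex) \<Rightarrow> bool" where
  "sheaf_of T Q U f \<longleftrightarrow> openin T U \<and> (\<forall>x\<in>U. \<exists>W. openin T W \<and> x \<in> W \<and> W \<subseteq> U \<and> Q W f)"

definition morphism :: "'a fun_space \<Rightarrow> 'b fun_space \<Rightarrow> ('a \<Rightarrow> 'b) \<Rightarrow> bool" where
  "morphism X Y \<phi> \<longleftrightarrow> continuous_map (zariski X) (zariski Y) \<phi> \<and>
     (\<forall>V f. openin (zariski Y) V \<longrightarrow> regular Y V f \<longrightarrow>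
        regular X {x \<in> topspace (zariski X). \<phi> x \<in> V} (f \<circ> \<phi>))"

definition isomorphic :: "'a fun_space \<Rightarrow> 'b fun_space \<Rightarrow> bool" where
  "isomorphic X Y \<longleftrightarrow> (\<exists>\<phi> \<psi>. morphism X Y \<phi> \<and> morphism Y X \<psi> \<and>
     (\<forall>x\<in>topspace (zariski X). \<psi> (\<phi> x) = x) \<and> (\<forall>y\<in>topspace (zariski Y). \<phi> (\<psi> y) = y))"


section \<open>Projective varieties\<close>

text \<open>
  A point of \<open>\<P>\<^sup>N(\<complex>)\<close> is the set of all its vectors of homogeneous coordinates.
\<close>

definition proj_points :: "nat \<Rightarrow> complex vec set set" where
  "proj_points N =
     (\<lambda>v. {t \<cdot>\<^sub>v v | t. t \<noteq> 0}) ` (carrier_vec (Suc N) - {0\<^sub>v (Suc N)})"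

text \<open>
  Homogeneous polynomials of degree \<open>d\<close> in \<open>N + 1\<close> variables, as functions (the field
  being infinite, nothing is lost); \<open>\<alpha>\<close> runs through the exponents of the monomials.
\<close>

definition hom_poly :: "nat \<Rightarrow> nat \<Rightarrow> (complex vec \<Rightarrow> complex) \<Rightarrow> bool" where
  "hom_poly N d F \<longleftrightarrow> (\<exists>E a. finite E \<and> (\<forall>\<alpha>\<in>E. (\<Sum>i\<le>N. \<alpha> i) = d) \<and>
     F = (\<lambda>v. \<Sum>\<alpha>\<in>E. a \<alpha> * (\<Prod>i\<le>N. (v $ i) ^ \<alpha> i)))"

text \<open>The complements of hypersurfaces form a basis of the Zariski topology.\<close>

definition proj_zariski :: "nat \<Rightarrow> complex vec set topology" where
  "proj_zariski N = topology_generated_by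
     {{p \<in> proj_points N. \<forall>v\<in>p. F v \<noteq> 0} | d F. hom_poly N d F}"

definition proj_fraction :: "nat \<Rightarrow> complex vec set set \<Rightarrow> (complex vec set \<Rightarrow> complex) \<Rightarrow> bool" where
  "proj_fraction N W f \<longleftrightarrow> (\<exists>d F G. hom_poly N d F \<and> hom_poly N d G \<and>
     (\<forall>p\<in>W. \<forall>v\<in>p. G v \<noteq> 0 \<and> f p = F v / G v))"

definition closed_subspace :: "nat \<Rightarrow> complex vec set set \<Rightarrow> complex vec set fun_space" where
  "closed_subspace N Z =
     \<lparr>zariski = subtopology (proj_zariski N) Z,
      regular = sheaf_of (subtopology (proj_zariski N) Z) (proj_fraction N)\<rparr>"

definition projective_variety :: "'a fun_space \<Rightarrow> bool" where
  "projective_variety X \<longleftrightarrow>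
     (\<exists>N Z. closedin (proj_zariski N) Z \<and> isomorphic X (closed_subspace N Z))"


section \<open>The toric variety of a fan\<close>

definition dual_monoid :: "nat \<Rightarrow> real vec set \<Rightarrow> int vec set" where
  "dual_monoid k \<sigma> = {m \<in> carrier_vec k. \<forall>u\<in>\<sigma>. 0 \<le> map_vec real_of_int m \<bullet> u}"

text \<open>
  The points of \<open>U\<^sub>\<sigma> = Spec \<complex>[\<sigma>\<^sup>\<or> \<inter> M]\<close> are the monoid homomorphisms from
  \<open>\<sigma>\<^sup>\<or> \<inter> M\<close> to \<open>(\<complex>, \<cdot>)\<close>; the coordinate ring is spanned by the characters
  \<open>\<gamma> \<mapsto> \<gamma> m\<close>.
\<close>

definition toric_chart :: "nat \<Rightarrow> real vec set \<Rightarrow> (int vec \<Rightarrow> complex) set" where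
  "toric_chart k \<sigma> = {\<gamma> \<in> extensional (dual_monoid k \<sigma>). \<gamma> (0\<^sub>v k) = 1 \<and>
     (\<forall>m\<in>dual_monoid k \<sigma>. \<forall>m'\<in>dual_monoid k \<sigma>. \<gamma> (m + m') = \<gamma> m * \<gamma> m')}"

definition coordinate_ring :: "nat \<Rightarrow> real vec set \<Rightarrow> ((int vec \<Rightarrow> complex) \<Rightarrow> complex) set" where
  "coordinate_ring k \<sigma> =
     {\<lambda>\<gamma>. \<Sum>m\<in>A. a m * \<gamma> m | A a. finite A \<and> A \<subseteq> dual_monoid k \<sigma>}"

definition chart_zariski :: "nat \<Rightarrow> real vec set \<Rightarrow> (int vec \<Rightarrow> complex) topology" where
  "chart_zariski k \<sigma> = topology_generated_by
     {{\<gamma> \<in> toric_chart k \<sigma>. F \<gamma> \<noteq> 0} | F. F \<in> coordinate_ring k \<sigma>}"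

definition chart_fraction ::
    "nat \<Rightarrow> real vec set \<Rightarrow> (int vec \<Rightarrow> complex) set \<Rightarrow> ((int vec \<Rightarrow> complex) \<Rightarrow> complex) \<Rightarrow> bool" where
  "chart_fraction k \<sigma> W f \<longleftrightarrow> (\<exists>F\<in>coordinate_ring k \<sigma>. \<exists>G\<in>coordinate_ring k \<sigma>.
     \<forall>\<gamma>\<in>W. G \<gamma> \<noteq> 0 \<and> f \<gamma> = F \<gamma> / G \<gamma>)"

text \<open>
  The charts of \<open>\<sigma>\<close> and \<open>\<sigma>'\<close> are glued along the chart of the common face
  \<open>\<sigma> \<inter> \<sigma>'\<close>, which is embedded into both by restriction of homomorphisms.
\<close>

definition gluing ::
    "nat \<Rightarrow> real vec set set \<Rightarrow> ((real vec set \<times> (int vec \<Rightarrow> complex)) rel)" where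
  "gluing k \<Sigma> = {((\<sigma>, \<gamma>), (\<sigma>', \<gamma>')). \<sigma> \<in> \<Sigma> \<and> \<sigma>' \<in> \<Sigma> \<and>
     \<gamma> \<in> toric_chart k \<sigma> \<and> \<gamma>' \<in> toric_chart k \<sigma>' \<and>
     (\<exists>\<delta>\<in>toric_chart k (\<sigma> \<inter> \<sigma>').
        \<gamma> = restrict \<delta> (dual_monoid k \<sigma>) \<and> \<gamma>' = restrict \<delta> (dual_monoid k \<sigma>'))}"

type_synonym toric_point = "(real vec set \<times> (int vec \<Rightarrow> complex)) set"

definition toric_points :: "nat \<Rightarrow> real vec set set \<Rightarrow> toric_point set" where
  "toric_points k \<Sigma> = (SIGMA \<sigma>:\<Sigma>. toric_chart k \<sigma>) // gluing k \<Sigma>"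

definition chart_preimage ::
    "nat \<Rightarrow> real vec set set \<Rightarrow> real vec set \<Rightarrow> toric_point set \<Rightarrow> (int vec \<Rightarrow> complex) set" where
  "chart_preimage k \<Sigma> \<sigma> V = {\<gamma> \<in> toric_chart k \<sigma>. gluing k \<Sigma> `` {(\<sigma>, \<gamma>)} \<in> V}"

definition toric_open :: "nat \<Rightarrow> real vec set set \<Rightarrow> toric_point set \<Rightarrow> bool" where
  "toric_open k \<Sigma> V \<longleftrightarrow> V \<subseteq> toric_points k \<Sigma> \<and>
     (\<forall>\<sigma>\<in>\<Sigma>. openin (chart_zariski k \<sigma>) (chart_preimage k \<Sigma> \<sigma> V))"

lemma istopology_toric_open: "istopology (toric_open k \<Sigma>)"
proof -
  have "chart_preimage k \<Sigma> \<sigma> (S \<inter> T) = chart_preimage k \<Sigma> \<sigma> S \<inter> chart_preimage k \<Sigma> \<sigma> T"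
    for \<sigma> S T by (auto simp: chart_preimage_def)
  moreover have "chart_preimage k \<Sigma> \<sigma> (\<Union>\<K>) = (\<Union>V\<in>\<K>. chart_preimage k \<Sigma> \<sigma> V)"
    for \<sigma> \<K> by (auto simp: chart_preimage_def)
  ultimately show ?thesis
    unfolding istopology_def toric_open_def by (auto intro!: openin_Union)
qed

definition toric_variety :: "nat \<Rightarrow> real vec set set \<Rightarrow> toric_point fun_space" where
  "toric_variety k \<Sigma> =
     \<lparr>zariski = topology (toric_open k \<Sigma>),
      regular = (\<lambda>V f. toric_open k \<Sigma> V \<and>
        (\<forall>\<sigma>\<in>\<Sigma>. sheaf_of (chart_zariski k \<sigma>) (chart_fraction k \<sigma>)
           (chart_preimage k \<Sigma> \<sigma> V) (\<lambda>\<gamma>. f (gluing k \<Sigma> `` {(\<sigma>, \<gamma>)}))))\<rparr>"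

definition projective_fan :: "nat \<Rightarrow> real vec set set \<Rightarrow> bool" where
  "projective_fan k \<Sigma> \<longleftrightarrow> projective_variety (toric_variety k \<Sigma>)"


section \<open>Integral sequences and Bott matrices\<close>

text \<open>
  Only the entries \<open>c i j\<close> with \<open>i < j < n\<close> of an integral sequence of length \<open>n\<close> are
  ever used.
\<close>

definition seq_matrix :: "nat \<Rightarrow> (nat \<Rightarrow> nat \<Rightarrow> int) \<Rightarrow> int mat" where
  "seq_matrix n c = mat n n (\<lambda>(i, j). if i < j then c i j else if i = j then 1 else 0)"

definition bott_matrix :: "nat \<Rightarrow> (nat \<Rightarrow> nat \<Rightarrow> int) \<Rightarrow> int mat" where
  "bott_matrix n c = - (THE D. D \<in> carrier_mat n n \<and>
     inverts_mat (seq_matrix n c) D \<and> inverts_mat D (seq_matrix n c))"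

lemma bott_matrix:
  shows "bott_matrix n c \<in> carrier_mat n n"
    and "seq_matrix n c * (- bott_matrix n c) = 1\<^sub>m n"
    and "(- bott_matrix n c) * seq_matrix n c = 1\<^sub>m n"
proof -
  let ?C = "seq_matrix n c"
  let ?P = "\<lambda>D. D \<in> carrier_mat n n \<and> inverts_mat ?C D \<and> inverts_mat D ?C"
  have C: "?C \<in> carrier_mat n n" by (simp add: seq_matrix_def)
  then have dC: "dim_row ?C = n" by simp
  have "upper_triangular ?C" by (auto simp: seq_matrix_def)
  then have "det ?C = prod_list (diag_mat ?C)" by (rule det_upper_triangular[OF _ C])
  also have "diag_mat ?C = replicate n 1"
    by (rule nth_equalityI) (auto simp: diag_mat_def seq_matrix_def)
  finally have "det ?C = 1" by simp
  then have adj: "?P (adj_mat ?C)"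
    using adj_mat[OF C] dC by (auto simp: inverts_mat_def intro!: eq_matI)
  have unique: "D = D'" if D: "?P D" and D': "?P D'" for D D'
  proof -
    have d: "D \<in> carrier_mat n n" "D' \<in> carrier_mat n n" "dim_row D = n"
      using D D' by auto
    have "D = D * (?C * D')" using d D' dC by (simp add: inverts_mat_def)
    also have "\<dots> = (D * ?C) * D'" using assoc_mult_mat[OF d(1) C d(2)] by simp
    also have "\<dots> = D'" using d D by (simp add: inverts_mat_def)
    finally show ?thesis .
  qed
  define D where "D = (THE D. ?P D)"
  have P: "?P D" unfolding D_def by (rule theI[of ?P, OF adj unique[OF _ adj]])
  have B: "bott_matrix n c = - D" unfolding bott_matrix_def D_def ..
  have dD: "dim_row D = n" using P by auto
  have D: "- bott_matrix n c = D" unfolding B by (rule uminus_uminus_mat)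
  show "bott_matrix n c \<in> carrier_mat n n" unfolding B using P by simp
  show "?C * (- bott_matrix n c) = 1\<^sub>m n" "(- bott_matrix n c) * ?C = 1\<^sub>m n"
    unfolding D using P dC dD by (simp_all add: inverts_mat_def)
qed

definition bott_ray :: "nat \<Rightarrow> nat \<Rightarrow> (nat \<Rightarrow> nat \<Rightarrow> int) \<Rightarrow> nat \<Rightarrow> nat \<Rightarrow> int vec" where
  "bott_ray n k c i w = (if w = 0 then unit_vec k i
     else vec k (\<lambda>j. if j < i then 0 else bott_matrix n c $$ (i, j)))"

definition bott_cone :: "nat \<Rightarrow> nat \<Rightarrow> (nat \<Rightarrow> nat \<Rightarrow> int) \<Rightarrow> (nat \<Rightarrow> nat) \<Rightarrow> real vec set" where
  "bott_cone n k c w = cone_hull k ((\<lambda>i. bott_ray n k c i (w i)) ` {..<k})"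

definition bott_fan :: "nat \<Rightarrow> nat \<Rightarrow> (nat \<Rightarrow> nat \<Rightarrow> int) \<Rightarrow> real vec set set" where
  "bott_fan n k c = {\<tau>. \<exists>w \<in> {..<k} \<rightarrow> {0, 1}. cone_face k \<tau> (bott_cone n k c w)}"

end

(*
  Proof idea. The fan is the normal fan of a polytope P all of whose vertices are smooth: P consists
  of the m with 0 <= m_i and <m, a_{i,1}> >= -height i, the height i growing so fast with decreasing
  i that P is combinatorially a cube, with vertices indexed by the words w, and that the first
  lattice point on each edge at a vertex is vertex w + edge w i, where edge w is the basis dual to
  the rays of the cone of w. For any such lattice polytope the support functions of the vertices
  show that the cones form a fan, and the monomials gamma |-> gamma (m - vertex w), m in P, map the
  toric variety to projective space. Two points of the charts are glued iff they have the same
  image, since a vanishing affine coordinate is visible on both sides. The image is cut out by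
  binomials: they determine a point with nonzero coordinate at vertex w by its coordinates at the
  vertex w + edge w i, which gives the inverse chart, and a nonzero coordinate of maximal norm must
  sit at a vertex, so these charts cover the image.
*)

theory Submission
  imports Defs
begin

section \<open>Fans of smooth lattice polytopes\<close>

text \<open>Projectivity is defined by an isomorphism with a closed subset of projective space, so
  inverse charts and defining equations have to be written down. Smoothness makes this feasible: at
  each vertex the edge vectors form a lattice basis, so the chart there is determined by
  \<open>k\<close> coordinates, and since the points \<open>vertex w + edge w i\<close> belong to
  \<open>P\<close>, these coordinates are quotients of homogeneous ones. Regular functions being
  functions on points, it is enough that the binomials cut out the right set; whether they generate
  the toric ideal is irrelevant. The maximality argument rests on the parallelogram law: a
  non-vertex m is the midpoint of m + x and m - x in \<open>P\<close>, a binomial makes both of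
  their coordinates nonzero as soon as the one at m is, and one of the two points is longer than m.
  For Bott towers the matrix entries have arbitrary signs, so the upper bound of m_i, which depends
  on the later coordinates, could become negative; the heights have to absorb this.\<close>

lemma scalar_prod_carrier:
  assumes "x \<in> carrier_vec k"
  shows "m \<bullet> x = (\<Sum>j<k. m $ j * x $ j)"
  using assms by (simp add: scalar_prod_def lessThan_atLeast0)

definition of_lattice :: "int vec \<Rightarrow> real vec" where
  "of_lattice = map_vec real_of_int"

lemma of_lattice_carrier [simp]: "of_lattice v \<in> carrier_vec k \<longleftrightarrow> v \<in> carrier_vec k"
  by (simp add: of_lattice_def)

lemma of_lattice_scalar_prod:
  assumes "v \<in> carrier_vec k" "m \<in> carrier_vec k"
  shows "of_lattice m \<bullet> of_lattice v = real_of_int (m \<bullet> v)"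
  using assms by (simp add: of_lattice_def scalar_prod_def)

text \<open>The corners of a polytope in lattice terms: \<open>ray w\<close> lists the inner facet
  normals at \<open>vertex w\<close>, and \<open>edge w\<close> is the dual basis.
  \<open>edge_ray\<close> and \<open>ray_edge\<close> say that the two matrices are inverse to each
  other on both sides. \<open>non_vertex\<close> is failure of extremality in midpoint form.
  \<open>finite_rays\<close> is a condition of its own because \<open>W\<close> may be infinite,
  with many indices for one vertex.\<close>

locale smooth_polytope =
  fixes k :: nat and W :: "'w set" and ray edge :: "'w \<Rightarrow> nat \<Rightarrow> int vec"
    and vertex :: "'w \<Rightarrow> int vec" and P :: "int vec set"
  assumes ray_carrier: "\<lbrakk>w \<in> W; i < k\<rbrakk> \<Longrightarrow> ray w i \<in> carrier_vec k"
    and edge_carrier: "\<lbrakk>w \<in> W; i < k\<rbrakk> \<Longrightarrow> edge w i \<in> carrier_vec k"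
    and edge_ray: "\<lbrakk>w \<in> W; i < k; j < k\<rbrakk> \<Longrightarrow> edge w i \<bullet> ray w j = (if i = j then 1 else 0)"
    and ray_edge: "\<lbrakk>w \<in> W; j < k; l < k\<rbrakk> \<Longrightarrow>
      (\<Sum>i<k. edge w i $ j * ray w i $ l) = (if j = l then 1 else 0)"
    and W_nonempty: "W \<noteq> {}"
    and finite_P: "finite P"
    and P_carrier: "P \<subseteq> carrier_vec k"
    and vertex_P: "w \<in> W \<Longrightarrow> vertex w \<in> P"
    and edge_P: "\<lbrakk>w \<in> W; i < k\<rbrakk> \<Longrightarrow> vertex w + edge w i \<in> P"
    and vertex_min: "\<lbrakk>w \<in> W; i < k; m \<in> P\<rbrakk> \<Longrightarrow> 0 \<le> (m - vertex w) \<bullet> ray w i"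
    and non_vertex: "\<lbrakk>m \<in> P; m \<notin> vertex ` W\<rbrakk> \<Longrightarrow>
      \<exists>x\<in>carrier_vec k. x \<noteq> 0\<^sub>v k \<and> m + x \<in> P \<and> m - x \<in> P"
    and finite_rays: "finite ((\<lambda>(w, i). ray w i) ` (W \<times> {..<k}))"
begin

declare ray_carrier [simp] edge_carrier [simp]

section \<open>Cones at a vertex in dual coordinates\<close>

abbreviation rray :: "'w \<Rightarrow> nat \<Rightarrow> real vec" where
  "rray w i \<equiv> of_lattice (ray w i)"

lemma rray_index [simp]:
  "\<lbrakk>w \<in> W; i < k; j < k\<rbrakk> \<Longrightarrow> rray w i $ j = real_of_int (ray w i $ j)"
  unfolding of_lattice_def by (metis carrier_vecD index_map_vec(1) ray_carrier)

lemma of_edge_index [simp]: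
  "\<lbrakk>w \<in> W; i < k; j < k\<rbrakk> \<Longrightarrow> of_lattice (edge w i) $ j = real_of_int (edge w i $ j)"
  unfolding of_lattice_def by (metis carrier_vecD index_map_vec(1) edge_carrier)

definition cone :: "'w \<Rightarrow> nat set \<Rightarrow> real vec set" where
  "cone w S = cone_hull k (ray w ` S)"

text \<open>The i-th coordinate of x in the basis \<open>ray w\<close>, read off with the dual
  basis.\<close>

definition coef :: "'w \<Rightarrow> nat \<Rightarrow> real vec \<Rightarrow> real" where
  "coef w i x = of_lattice (edge w i) \<bullet> x"

definition normal_fan :: "real vec set set" where
  "normal_fan = {cone w S | w S. w \<in> W \<and> S \<subseteq> {..<k}}"

lemma ray_inj: "w \<in> W \<Longrightarrow> inj_on (ray w) {..<k}"
  by (rule inj_onI) (metis edge_ray lessThan_iff zero_neq_one)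

lemma coef_ray:
  assumes "w \<in> W" "i < k" "j < k"
  shows "coef w i (rray w j) = (if i = j then 1 else 0)"
  using assms by (simp add: coef_def of_lattice_scalar_prod[OF ray_carrier edge_carrier] edge_ray)

lemma expand:
  assumes "w \<in> W" "x \<in> carrier_vec k" "l < k"
  shows "x $ l = (\<Sum>i<k. coef w i x * rray w i $ l)"
proof -
  have "(\<Sum>i<k. coef w i x * rray w i $ l)
      = (\<Sum>i<k. \<Sum>j<k. real_of_int (edge w i $ j) * x $ j * real_of_int (ray w i $ l))"
    using assms
    by (intro sum.cong refl)
      (simp add: coef_def scalar_prod_carrier[OF assms(2)] sum_distrib_right)
  also have "\<dots> = (\<Sum>j<k. \<Sum>i<k. real_of_int (edge w i $ j) * x $ j * real_of_int (ray w i $ l))"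
    by (rule sum.swap)
  also have "\<dots> = (\<Sum>j<k. x $ j * real_of_int (\<Sum>i<k. edge w i $ j * ray w i $ l))"
    by (simp add: sum_distrib_left mult_ac)
  also have "\<dots> = (\<Sum>j<k. if j = l then x $ j else 0)"
    using assms by (intro sum.cong refl) (simp add: ray_edge del: of_int_sum)
  also have "\<dots> = x $ l" using assms by simp
  finally show ?thesis ..
qed

lemma coef_inject:
  assumes "w \<in> W" "x \<in> carrier_vec k" "y \<in> carrier_vec k" "\<And>i. i < k \<Longrightarrow> coef w i x = coef w i y"
  shows "x = y"
proof (rule eq_vecI)
  show "dim_vec x = dim_vec y" using assms by simp
  fix l assume "l < dim_vec y"
  then have "l < k" using assms by simp
  then show "x $ l = y $ l"
    using assms by (simp only: expand[OF assms(1,2)] expand[OF assms(1,3)]) simp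
qed

lemma scalar_prod_expand:
  assumes "w \<in> W" "x \<in> carrier_vec k"
  shows "m \<bullet> x = (\<Sum>i<k. coef w i x * (m \<bullet> rray w i))"
proof -
  have "m \<bullet> x = (\<Sum>l<k. m $ l * (\<Sum>i<k. coef w i x * rray w i $ l))"
    by (simp add: scalar_prod_carrier[OF assms(2)] expand[OF assms, symmetric])
  also have "\<dots> = (\<Sum>i<k. \<Sum>l<k. coef w i x * (m $ l * rray w i $ l))"
    by (subst sum.swap) (simp add: sum_distrib_left mult_ac)
  also have "\<dots> = (\<Sum>i<k. coef w i x * (m \<bullet> rray w i))"
    using assms ray_carrier
    by (intro sum.cong refl)
      (subst scalar_prod_carrier[of _ k]; simp add: sum_distrib_left)
  finally show ?thesis .
qed

lemma coef_of_sum: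
  assumes "w \<in> W" "x \<in> carrier_vec k" "\<And>l. l < k \<Longrightarrow> x $ l = (\<Sum>i<k. f i * rray w i $ l)" "i < k"
  shows "coef w i x = f i"
proof -
  have "coef w i x = (\<Sum>l<k. of_lattice (edge w i) $ l * (\<Sum>j<k. f j * rray w j $ l))"
    using assms by (simp add: coef_def scalar_prod_carrier[OF assms(2)])
  also have "\<dots> = (\<Sum>j<k. \<Sum>l<k. f j * (of_lattice (edge w i) $ l * rray w j $ l))"
    by (subst sum.swap) (simp add: sum_distrib_left mult_ac)
  also have "\<dots> = (\<Sum>j<k. f j * coef w i (rray w j))"
    using assms ray_carrier unfolding coef_def
    by (intro sum.cong refl)
      (subst scalar_prod_carrier[of _ k]; simp add: sum_distrib_left)
  also have "\<dots> = (\<Sum>j<k. if i = j then f j else 0)"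
    using assms by (intro sum.cong refl) (simp add: coef_ray)
  also have "\<dots> = f i" using assms(4) by simp
  finally show ?thesis .
qed

text \<open>The rays are linearly independent, so the multipliers in \<open>cone_hull\<close> are
  forced to be the dual coordinates. Membership thus becomes a list of sign conditions, the form in
  which cones are handled from here on.\<close>

lemma mem_cone:
  assumes w: "w \<in> W" and S: "S \<subseteq> {..<k}"
  shows "x \<in> cone w S \<longleftrightarrow>
    x \<in> carrier_vec k \<and> (\<forall>i<k. 0 \<le> coef w i x \<and> (i \<notin> S \<longrightarrow> coef w i x = 0))"
proof
  assume "x \<in> cone w S"
  then obtain f where x: "x \<in> carrier_vec k" and f: "\<forall>v\<in>ray w ` S. 0 \<le> f v"
    and e: "\<forall>j<k. x $ j = (\<Sum>v\<in>ray w ` S. f v * real_of_int (v $ j))"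
    by (auto simp: cone_def cone_hull_def)
  define g where "g i = (if i \<in> S then f (ray w i) else 0)" for i
  have inj: "inj_on (ray w) S" using ray_inj[OF w] S by (rule inj_on_subset)
  have "x $ l = (\<Sum>i<k. g i * rray w i $ l)" if l: "l < k" for l
  proof -
    have "x $ l = (\<Sum>i\<in>S. f (ray w i) * real_of_int (ray w i $ l))"
      using e l by (simp add: sum.reindex[OF inj])
    also have "\<dots> = (\<Sum>i\<in>S. g i * rray w i $ l)"
      using S w l by (intro sum.cong refl) (auto simp: g_def subset_iff)
    also have "\<dots> = (\<Sum>i<k. g i * rray w i $ l)"
      using S by (intro sum.mono_neutral_left) (auto simp: g_def)
    finally show ?thesis .
  qed
  from coef_of_sum[OF w x this]
  show "x \<in> carrier_vec k \<and> (\<forall>i<k. 0 \<le> coef w i x \<and> (i \<notin> S \<longrightarrow> coef w i x = 0))"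
    using x f by (auto simp: g_def)
next
  assume x: "x \<in> carrier_vec k \<and> (\<forall>i<k. 0 \<le> coef w i x \<and> (i \<notin> S \<longrightarrow> coef w i x = 0))"
  \<comment> \<open>\<open>cone_hull\<close> takes multipliers on the set of rays, not on indices;
    injectivity of \<open>ray w\<close> allows passing back to the index.\<close>
  define f where "f v = coef w (the_inv_into {..<k} (ray w) v) x" for v
  have inj: "inj_on (ray w) S" using ray_inj[OF w] S by (rule inj_on_subset)
  have f: "f (ray w i) = coef w i x" if "i < k" for i
    using that by (simp add: f_def the_inv_into_f_f[OF ray_inj[OF w]])
  have "x $ j = (\<Sum>v\<in>ray w ` S. f v * real_of_int (v $ j))" if j: "j < k" for j
  proof -
    have "x $ j = (\<Sum>i<k. coef w i x * rray w i $ j)"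
      using expand[OF w _ j] x by blast
    also have "\<dots> = (\<Sum>i\<in>S. coef w i x * rray w i $ j)"
      using S x by (intro sum.mono_neutral_right) auto
    also have "\<dots> = (\<Sum>i\<in>S. f (ray w i) * real_of_int (ray w i $ j))"
      using S w j by (intro sum.cong refl) (auto simp: f subset_iff)
    finally show ?thesis by (simp add: sum.reindex[OF inj])
  qed
  then show "x \<in> cone w S"
    using x S f by (auto simp: cone_def cone_hull_def intro!: exI[of _ f])
qed

section \<open>Full cones, intersections and faces\<close>

lemma ray_cone_iff:
  assumes "w \<in> W" "S \<subseteq> {..<k}" "i < k"
  shows "rray w i \<in> cone w S \<longleftrightarrow> i \<in> S"
  using assms ray_carrier by (auto simp: mem_cone coef_ray split: if_splits)

lemma cone_mono:
  assumes "w \<in> W" "S \<subseteq> T" "T \<subseteq> {..<k}"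
  shows "cone w S \<subseteq> cone w T"
  using assms mem_cone[OF assms(1) subset_trans[OF assms(2,3)]] mem_cone[OF assms(1,3)] by blast

text \<open>One direction expands x in the rays and uses \<open>vertex_min\<close>; the other tests
  only the points \<open>vertex w + edge w i\<close>, where the value at x exceeds that of
  \<open>vertex w\<close> by \<open>coef w i x\<close>. Minimality does not refer to the basis at w,
  which makes the cones of different vertices comparable.\<close>

lemma mem_full_cone:
  assumes "w \<in> W"
  shows "x \<in> cone w {..<k} \<longleftrightarrow>
    x \<in> carrier_vec k \<and> (\<forall>m\<in>P. of_lattice (vertex w) \<bullet> x \<le> of_lattice m \<bullet> x)"
proof (cases "x \<in> carrier_vec k")
  case x: True
  have add: "of_lattice (m + m') \<bullet> x = of_lattice m \<bullet> x + of_lattice m' \<bullet> x"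
    if "m \<in> carrier_vec k" "m' \<in> carrier_vec k" for m m'
    using x that by (simp add: scalar_prod_carrier of_lattice_def algebra_simps sum.distrib)
  have c: "vertex w \<in> carrier_vec k" using assms vertex_P P_carrier by auto
  have diff: "of_lattice m \<bullet> x = of_lattice (vertex w) \<bullet> x
      + (\<Sum>i<k. coef w i x * real_of_int ((m - vertex w) \<bullet> ray w i))" if "m \<in> P" for m
  proof -
    have m: "m \<in> carrier_vec k" using that P_carrier by auto
    have "m = vertex w + (m - vertex w)" using m c by auto
    then have "of_lattice m \<bullet> x = of_lattice (vertex w) \<bullet> x + of_lattice (m - vertex w) \<bullet> x"
      using add m c by (metis minus_carrier_vec)
    then show ?thesis
      using scalar_prod_expand[OF assms x, of "of_lattice (m - vertex w)"] c m ray_carrier assms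
      by (simp add: of_lattice_scalar_prod[of _ k])
  qed
  show ?thesis
  proof (intro iffI conjI ballI x)
    fix m assume "x \<in> cone w {..<k}" "m \<in> P"
    then show "of_lattice (vertex w) \<bullet> x \<le> of_lattice m \<bullet> x"
      using assms diff[of m]
      by (auto simp: mem_cone intro!: sum_nonneg mult_nonneg_nonneg vertex_min)
  next
    assume *: "x \<in> carrier_vec k \<and> (\<forall>m\<in>P. of_lattice (vertex w) \<bullet> x \<le> of_lattice m \<bullet> x)"
    have "0 \<le> coef w i x" if "i < k" for i
      using * edge_P[OF assms that] add[OF c edge_carrier[OF assms that]]
      by (fastforce simp: coef_def)
    then show "x \<in> cone w {..<k}" using assms x by (simp add: mem_cone)
  qed
qed (use assms in \<open>simp add: mem_cone\<close>)

text \<open>The intersection is spanned by rays of the first cone, hence will be a face of it. A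
  point of both cones has equal values at the two vertices, and a vanishing sum of nonnegative terms
  can be split ray by ray.\<close>

lemma cone_inter:
  assumes w: "w \<in> W" "S \<subseteq> {..<k}" and w': "w' \<in> W" "S' \<subseteq> {..<k}"
  shows "cone w S \<inter> cone w' S' = cone w {i \<in> S. rray w i \<in> cone w' S'}" (is "_ = cone w ?T")
proof -
  have T: "?T \<subseteq> {..<k}" using w by auto
  show ?thesis
  proof (intro subset_antisym subsetI IntI)
    fix x assume x: "x \<in> cone w ?T"
    have "?T \<subseteq> S" by auto
    from cone_mono[OF w(1) this w(2)] x show "x \<in> cone w S" by (rule subsetD)
    have xk: "x \<in> carrier_vec k" using x mem_cone[OF w(1) T] by blast
    have cx: "coef w i x = 0 \<or> (coef w i x > 0 \<and> i \<in> ?T)" if "i < k" for i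
      using x that mem_cone[OF w(1) T, of x] by fastforce
    have e: "coef w' j x = (\<Sum>i<k. coef w i x * coef w' j (rray w i))" for j
      unfolding coef_def[of w'] by (rule scalar_prod_expand[OF w(1) xk])
    have n: "coef w i x * coef w' j (rray w i) \<ge> 0 \<and>
        (j \<notin> S' \<longrightarrow> coef w i x * coef w' j (rray w i) = 0)" if "i < k" "j < k" for i j
      using cx[OF that(1)] that mem_cone[OF w'] by auto
    show "x \<in> cone w' S'"
      unfolding mem_cone[OF w'] using xk n
      by (auto simp: e intro!: sum_nonneg sum.neutral)
  next
    fix x assume "x \<in> cone w S \<inter> cone w' S'"
    then have x: "x \<in> cone w S" "x \<in> cone w' S'" by auto
    have xk: "x \<in> carrier_vec k" using x mem_cone[OF w] by blast
    have full: "x \<in> cone w {..<k}" "x \<in> cone w' {..<k}"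
      using x cone_mono[OF w(1) w(2) subset_refl] cone_mono[OF w'(1) w'(2) subset_refl] by auto
    have eq: "of_lattice (vertex w) \<bullet> x = of_lattice (vertex w') \<bullet> x"
      using full w w' by (auto simp: mem_full_cone vertex_P intro!: antisym)
    have rk: "rray w i \<in> carrier_vec k" if "i < k" for i using ray_carrier[OF w(1) that] by simp
    have rf: "rray w i \<in> cone w {..<k}" if "i < k" for i
      using ray_cone_iff[OF w(1) subset_refl that] that by simp
    \<comment> \<open>The two vertices agree on \<open>x\<close>, and the first minimises on each ray; hence both
      minimise on each ray that occurs in \<open>x\<close>.\<close>
    have pos: "rray w i \<in> cone w' {..<k}" if i: "i < k" "coef w i x \<noteq> 0" for i
    proof -
      have nn: "0 \<le> coef w j x * (of_lattice (vertex w') \<bullet> rray w j - of_lattice (vertex w) \<bullet> rray w j)"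
        if "j < k" for j
      proof (rule mult_nonneg_nonneg)
        show "0 \<le> coef w j x" using full(1) that w by (simp add: mem_cone)
        show "0 \<le> of_lattice (vertex w') \<bullet> rray w j - of_lattice (vertex w) \<bullet> rray w j"
          using rf[OF that] w w' by (simp add: mem_full_cone vertex_P)
      qed
      have "(\<Sum>j<k. coef w j x * (of_lattice (vertex w') \<bullet> rray w j - of_lattice (vertex w) \<bullet> rray w j)) = 0"
        using eq scalar_prod_expand[OF w(1) xk] by (simp add: right_diff_distrib sum_subtractf)
      then have "coef w i x * (of_lattice (vertex w') \<bullet> rray w i - of_lattice (vertex w) \<bullet> rray w i) = 0"
        using nn i by (subst (asm) sum_nonneg_eq_0_iff) auto
      then show ?thesis
        using rf[OF i(1)] i rk w w' by (auto simp: mem_full_cone)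
    qed
    have "rray w i \<in> cone w' S'" if i: "i < k" "coef w i x \<noteq> 0" for i
    proof -
      \<comment> \<open>The j-th coordinate of x at w' is zero, and every ray occurring in x
        contributes a nonnegative amount to it.\<close>
      have "coef w' j (rray w i) = 0" if j: "j < k" "j \<notin> S'" for j
      proof -
        have nn: "0 \<le> coef w l x * coef w' j (rray w l)" if "l < k" for l
        proof (cases "coef w l x = 0")
          case False
          then show ?thesis using pos[OF that False] that j w w' full(1) by (auto simp: mem_cone)
        qed auto
        have "(\<Sum>l<k. coef w l x * coef w' j (rray w l)) = coef w' j x"
          unfolding coef_def[of w'] by (rule scalar_prod_expand[OF w(1) xk, symmetric])
        also have "\<dots> = 0" using x(2) j mem_cone[OF w'] by blast
        finally have "coef w i x * coef w' j (rray w i) = 0"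
          using nn i by (subst (asm) sum_nonneg_eq_0_iff) auto
        then show ?thesis using i by simp
      qed
      then show ?thesis using pos[OF i] w' by (auto simp: mem_cone)
    qed
    then show "x \<in> cone w ?T"
      unfolding mem_cone[OF w(1) T] using x(1) mem_cone[OF w] by blast
  qed
qed

text \<open>A supporting functional is nonnegative on the rays, so it vanishes at a point of the
  cone exactly when it vanishes on every ray used there; \<open>T\<close> collects the rays it
  kills.\<close>

lemma cone_face_iff:
  assumes w: "w \<in> W" "S \<subseteq> {..<k}"
  shows "cone_face k \<tau> (cone w S) \<longleftrightarrow> (\<exists>T\<subseteq>S. \<tau> = cone w T)"
proof
  assume "cone_face k \<tau> (cone w S)"
  then obtain m where m: "m \<in> carrier_vec k" "\<forall>u\<in>cone w S. 0 \<le> m \<bullet> u"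
    "\<tau> = {u \<in> cone w S. m \<bullet> u = 0}" by (auto simp: cone_face_def)
  let ?T = "{i \<in> S. m \<bullet> rray w i = 0}"
  have T: "?T \<subseteq> {..<k}" using w by auto
  have mi: "0 \<le> m \<bullet> rray w i" if "i \<in> S" for i
    using m that ray_cone_iff[OF w] w by auto
  have "m \<bullet> x = 0 \<longleftrightarrow> (\<forall>i<k. i \<notin> ?T \<longrightarrow> coef w i x = 0)" if x: "x \<in> cone w S" for x
  proof -
    have "m \<bullet> x = (\<Sum>i<k. coef w i x * (m \<bullet> rray w i))"
      using scalar_prod_expand[OF w(1)] x mem_cone[OF w] by blast
    moreover have "0 \<le> coef w i x * (m \<bullet> rray w i)" if "i < k" for i
      using x mi[of i] that mem_cone[OF w, of x] by (cases "i \<in> S") auto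
    ultimately have "m \<bullet> x = 0 \<longleftrightarrow> (\<forall>i<k. coef w i x * (m \<bullet> rray w i) = 0)"
      by (simp only:) (subst sum_nonneg_eq_0_iff; auto)
    also have "\<dots> \<longleftrightarrow> (\<forall>i<k. i \<notin> ?T \<longrightarrow> coef w i x = 0)"
      using x mem_cone[OF w, of x] by auto
    finally show ?thesis .
  qed
  then have "\<tau> = cone w ?T"
    using mem_cone[OF w] mem_cone[OF w(1) T] by (auto simp: m(3))
  then show "\<exists>T\<subseteq>S. \<tau> = cone w T" by (intro exI[of _ ?T] conjI) auto
next
  assume "\<exists>T\<subseteq>S. \<tau> = cone w T"
  then obtain T where T: "T \<subseteq> S" "\<tau> = cone w T" by blast
  have Tk: "T \<subseteq> {..<k}" using T w by auto
  \<comment> \<open>The sum of the dual vectors over \<open>S - T\<close>. Its value at x is the sum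
    of the coordinates of x in \<open>S - T\<close>, which on the cone is zero only if each of them
    is.\<close>
  define m where "m = vec k (\<lambda>j. \<Sum>i\<in>S - T. of_lattice (edge w i) $ j)"
  have mx: "m \<bullet> x = (\<Sum>i\<in>S - T. coef w i x)" if "x \<in> carrier_vec k" for x
  proof -
    have "m \<bullet> x = (\<Sum>j<k. \<Sum>i\<in>S - T. of_lattice (edge w i) $ j * x $ j)"
      by (simp add: scalar_prod_carrier[OF that] m_def sum_distrib_right)
    also have "\<dots> = (\<Sum>i\<in>S - T. coef w i x)"
      by (subst sum.swap) (simp add: coef_def scalar_prod_carrier[OF that])
    finally show ?thesis .
  qed
  have fin: "finite (S - T)" using w finite_subset by blast
  show "cone_face k \<tau> (cone w S)"
    unfolding cone_face_def
  proof (intro bexI conjI ballI)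
    show "m \<in> carrier_vec k" by (simp add: m_def)
    show "0 \<le> m \<bullet> x" if "x \<in> cone w S" for x
      using that w mem_cone[OF w, of x] by (auto simp: mx intro!: sum_nonneg)
    show "\<tau> = {x \<in> cone w S. m \<bullet> x = 0}"
    proof (rule Set.set_eqI)
      fix x
      show "x \<in> \<tau> \<longleftrightarrow> x \<in> {x \<in> cone w S. m \<bullet> x = 0}"
      proof (cases "x \<in> cone w S")
        case True
        then have "x \<in> carrier_vec k" "\<And>i. i \<in> S - T \<Longrightarrow> 0 \<le> coef w i x"
          using w mem_cone[OF w, of x] by auto
        then have "m \<bullet> x = 0 \<longleftrightarrow> (\<forall>i\<in>S - T. coef w i x = 0)"
          using mx sum_nonneg_eq_0_iff[OF fin, of "\<lambda>i. coef w i x"] by simp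
        then show ?thesis using True T w mem_cone[OF w, of x] mem_cone[OF w(1) Tk, of x] by auto
      next
        case False
        then show ?thesis using T cone_mono[OF w(1) T(1) w(2)] by blast
      qed
    qed
  qed
qed

lemma fan_normal_fan: "fan k normal_fan"
  unfolding fan_def
proof (intro conjI ballI allI impI)
  \<comment> \<open>\<open>W\<close> may be infinite; finiteness holds because a cone depends only
    on the set of its rays.\<close>
  have "normal_fan \<subseteq> cone_hull k ` Pow ((\<lambda>(w, i). ray w i) ` (W \<times> {..<k}))"
  proof
    fix \<sigma> assume "\<sigma> \<in> normal_fan"
    then obtain w S where "w \<in> W" "S \<subseteq> {..<k}" "\<sigma> = cone_hull k (ray w ` S)"
      by (auto simp: normal_fan_def cone_def)
    then show "\<sigma> \<in> cone_hull k ` Pow ((\<lambda>(w, i). ray w i) ` (W \<times> {..<k}))"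
      by (intro image_eqI[of _ _ "ray w ` S"]) auto
  qed
  then show "finite normal_fan" using finite_rays by (auto intro: finite_subset)
next
  fix \<sigma> assume "\<sigma> \<in> normal_fan"
  then obtain w S where w: "w \<in> W" "S \<subseteq> {..<k}" and \<sigma>: "\<sigma> = cone w S"
    by (auto simp: normal_fan_def)
  show "rational_cone k \<sigma>"
    unfolding rational_cone_def \<sigma> cone_def
    using w ray_carrier finite_subset[OF w(2)] by (intro exI[of _ "ray w ` S"]) auto
  show "strongly_convex k \<sigma>"
    unfolding strongly_convex_def
  proof (intro subset_antisym subsetI)
    fix x assume "x \<in> \<sigma> \<inter> uminus ` \<sigma>"
    then obtain y where y: "x \<in> \<sigma>" "y \<in> \<sigma>" "x = - y" by auto
    have yk: "y \<in> carrier_vec k" "x \<in> carrier_vec k" using y mem_cone[OF w] \<sigma> by blast+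
    have "coef w i x = - coef w i y" for i
      unfolding coef_def y(3) using yk(1) by (simp add: scalar_prod_carrier[of _ k] sum_negf)
    then have "coef w i x = 0" if "i < k" for i
      using y that by (fastforce simp: \<sigma> mem_cone[OF w])
    moreover have "coef w i (0\<^sub>v k) = 0" for i by (simp add: coef_def scalar_prod_carrier[of _ k])
    ultimately show "x \<in> {0\<^sub>v k}" using coef_inject[OF w(1) yk(2), of "0\<^sub>v k"] by simp
  next
    fix x :: "real vec" assume "x \<in> {0\<^sub>v k}"
    moreover have "coef w i (0\<^sub>v k) = 0" for i by (simp add: coef_def scalar_prod_carrier[of _ k])
    moreover have "0\<^sub>v k = - (0\<^sub>v k :: real vec)" by auto
    ultimately show "x \<in> \<sigma> \<inter> uminus ` \<sigma>"
      by (auto simp: \<sigma> mem_cone[OF w] intro!: image_eqI[of _ uminus "0\<^sub>v k"])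
  qed
next
  fix \<sigma> \<tau> assume "\<sigma> \<in> normal_fan" "cone_face k \<tau> \<sigma>"
  then show "\<tau> \<in> normal_fan"
    unfolding normal_fan_def using cone_face_iff subset_trans by (smt (verit) mem_Collect_eq)
next
  have face: "cone_face k (\<sigma> \<inter> \<sigma>') \<sigma>" if "\<sigma> \<in> normal_fan" "\<sigma>' \<in> normal_fan" for \<sigma> \<sigma>'
  proof -
    obtain w S w' S' where w: "w \<in> W" "S \<subseteq> {..<k}" "w' \<in> W" "S' \<subseteq> {..<k}"
      and "\<sigma> = cone w S" "\<sigma>' = cone w' S'"
      using \<open>\<sigma> \<in> normal_fan\<close> \<open>\<sigma>' \<in> normal_fan\<close> unfolding normal_fan_def by blast
    then show ?thesis using cone_face_iff[OF w(1,2)] cone_inter[OF w]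
      by (auto intro!: exI[of _ "{i \<in> S. rray w i \<in> cone w' S'}"])
  qed
  fix \<sigma> \<sigma>' assume "\<sigma> \<in> normal_fan" "\<sigma>' \<in> normal_fan"
  then show "cone_face k (\<sigma> \<inter> \<sigma>') \<sigma>" "cone_face k (\<sigma> \<inter> \<sigma>') \<sigma>'"
    using face[of \<sigma> \<sigma>'] face[of \<sigma>' \<sigma>] by (auto simp: Int_commute)
qed

text \<open>The coordinates of a lattice vector are its pairings with the dual basis and therefore
  integers; existence and uniqueness are inherited from the real expansion.\<close>

lemma lattice_basis_rays:
  assumes w: "w \<in> W"
  shows "lattice_basis k (ray w ` {..<k})" (is "lattice_basis k ?B")
  unfolding lattice_basis_def
proof (intro conjI ballI)
  show "finite ?B" by simp
  show "?B \<subseteq> carrier_vec k" using ray_carrier[OF w] by auto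
  fix v :: "int vec" assume v: "v \<in> carrier_vec k"
  note inj = ray_inj[OF w]
  let ?f = "\<lambda>b. edge w (the_inv_into {..<k} (ray w) b) \<bullet> v"
  have f: "?f (ray w i) = edge w i \<bullet> v" if "i < k" for i
    using that by (simp add: the_inv_into_f_f[OF inj])
  have coef_v: "coef w i (of_lattice v) = real_of_int (edge w i \<bullet> v)" if "i < k" for i
    unfolding coef_def using of_lattice_scalar_prod[OF v] edge_carrier[OF w that] by simp
  show "\<exists>!l. l \<in> extensional ?B \<and> (\<forall>i<k. v $ i = (\<Sum>b\<in>?B. l b * b $ i))"
  proof (rule ex1I[of _ "restrict ?f ?B"], intro conjI allI impI)
    fix j assume j: "j < k"
    have "real_of_int (v $ j) = (\<Sum>i<k. coef w i (of_lattice v) * rray w i $ j)"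
      using expand[OF w, of "of_lattice v" j] v j by (simp add: of_lattice_def)
    also have "\<dots> = real_of_int (\<Sum>i<k. (edge w i \<bullet> v) * ray w i $ j)"
      using w j by (simp add: coef_v)
    finally have "v $ j = (\<Sum>i<k. (edge w i \<bullet> v) * ray w i $ j)"
      using of_int_eq_iff by blast
    then show "v $ j = (\<Sum>b\<in>?B. restrict ?f ?B b * b $ j)"
      by (simp add: sum.reindex[OF inj] f)
  next
    fix l assume l: "l \<in> extensional ?B \<and> (\<forall>i<k. v $ i = (\<Sum>b\<in>?B. l b * b $ i))"
    have "real_of_int (edge w i \<bullet> v) = real_of_int (l (ray w i))" if i: "i < k" for i
    proof -
      have "of_lattice v $ j = (\<Sum>i<k. real_of_int (l (ray w i)) * rray w i $ j)" if j: "j < k" for j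
      proof -
        have "of_lattice v $ j = real_of_int (v $ j)" using j v by (simp add: of_lattice_def)
        then show ?thesis using j l w by (simp add: sum.reindex[OF inj])
      qed
      from coef_of_sum[OF w _ this i] show ?thesis using v coef_v[OF i] by simp
    qed
    then have "l (ray w i) = edge w i \<bullet> v" if "i < k" for i using that by simp
    then show "l = restrict ?f ?B"
      using l by (intro extensionalityI[of _ ?B]) (auto simp: f)
  qed simp
qed

lemma smooth_normal_fan: "smooth_fan k normal_fan"
  unfolding smooth_fan_def normal_fan_def cone_def
proof clarify
  fix w S assume "w \<in> W" "S \<subseteq> {..<k}"
  then show "\<exists>B A. lattice_basis k B \<and> A \<subseteq> B \<and> cone_hull k (ray w ` S) = cone_hull k A"
    using lattice_basis_rays[of w] by blast
qed

end

section \<open>Toric charts\<close>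

context smooth_polytope
begin

abbreviation full :: "'w \<Rightarrow> real vec set" where
  "full w \<equiv> cone w {..<k}"

lemma cone_carrier: "cone w S \<subseteq> carrier_vec k"
  by (auto simp: cone_def cone_hull_def)

lemma vertex_carrier [simp]: "w \<in> W \<Longrightarrow> vertex w \<in> carrier_vec k"
  using vertex_P P_carrier by auto

lemma P_carrierD [simp]: "m \<in> P \<Longrightarrow> m \<in> carrier_vec k"
  using P_carrier by auto

lemma dim_simps [simp]:
  "w \<in> W \<Longrightarrow> dim_vec (vertex w) = k"
  "m \<in> P \<Longrightarrow> dim_vec m = k"
  "\<lbrakk>w \<in> W; i < k\<rbrakk> \<Longrightarrow> dim_vec (edge w i) = k"
  using carrier_vecD[OF vertex_carrier] carrier_vecD[OF P_carrierD] carrier_vecD[OF edge_carrier]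
  by auto

section \<open>Dual monoids of cones\<close>

lemma dual_monoid_carrier: "r \<in> dual_monoid k \<sigma> \<Longrightarrow> r \<in> carrier_vec k"
  by (simp add: dual_monoid_def)

lemma dual_monoid_anti: "\<sigma> \<subseteq> \<tau> \<Longrightarrow> dual_monoid k \<tau> \<subseteq> dual_monoid k \<sigma>"
  by (auto simp: dual_monoid_def)

lemma zero_dual_monoid:
  assumes "\<sigma> \<subseteq> carrier_vec k"
  shows "0\<^sub>v k \<in> dual_monoid k \<sigma>"
proof -
  have "map_vec real_of_int (0\<^sub>v k) \<bullet> x = 0" if "x \<in> \<sigma>" for x
    using that assms by (subst scalar_prod_carrier[of _ k]) auto
  then show ?thesis by (simp add: dual_monoid_def)
qed

lemma add_dual_monoid:
  assumes "\<sigma> \<subseteq> carrier_vec k" "r \<in> dual_monoid k \<sigma>" "s \<in> dual_monoid k \<sigma>"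
  shows "r + s \<in> dual_monoid k \<sigma>"
proof -
  have c: "r \<in> carrier_vec k" "s \<in> carrier_vec k" using assms by (auto simp: dual_monoid_def)
  have "map_vec real_of_int (r + s) = map_vec real_of_int r + map_vec real_of_int s"
    using c by auto
  moreover have "(map_vec real_of_int r + map_vec real_of_int s) \<bullet> x
      = map_vec real_of_int r \<bullet> x + map_vec real_of_int s \<bullet> x" if "x \<in> \<sigma>" for x
    using c that assms(1) by (intro add_scalar_prod_distrib[of _ k]) auto
  ultimately show ?thesis using assms by (auto simp: dual_monoid_def)
qed

lemma dual_monoid_cone:
  assumes w: "w \<in> W" "S \<subseteq> {..<k}"
  shows "dual_monoid k (cone w S) = {r \<in> carrier_vec k. \<forall>i\<in>S. 0 \<le> r \<bullet> ray w i}"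
proof (intro subset_antisym subsetI CollectI conjI ballI)
  fix r assume r: "r \<in> dual_monoid k (cone w S)"
  then show rk: "r \<in> carrier_vec k" by (rule dual_monoid_carrier)
  fix i assume i: "i \<in> S"
  then have "rray w i \<in> cone w S" using ray_cone_iff[OF w] w by auto
  then have "0 \<le> of_lattice r \<bullet> rray w i" using r by (simp add: dual_monoid_def of_lattice_def)
  then show "0 \<le> r \<bullet> ray w i"
    using i w rk of_lattice_scalar_prod[of "ray w i" k r] by (auto simp: subset_iff)
next
  fix r assume r: "r \<in> {r \<in> carrier_vec k. \<forall>i\<in>S. 0 \<le> r \<bullet> ray w i}"
  have "0 \<le> of_lattice r \<bullet> x" if x: "x \<in> cone w S" for x
  proof -
    have "0 \<le> coef w i x * (of_lattice r \<bullet> rray w i)" if "i < k" for i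
      using x mem_cone[OF w, of x] r w that of_lattice_scalar_prod[of "ray w i" k r]
      by (cases "i \<in> S") auto
    then have "0 \<le> (\<Sum>i<k. coef w i x * (of_lattice r \<bullet> rray w i))" by (auto intro: sum_nonneg)
    then show ?thesis using scalar_prod_expand[OF w(1)] x cone_carrier by (metis subsetD)
  qed
  then show "r \<in> dual_monoid k (cone w S)" using r by (simp add: dual_monoid_def of_lattice_def)
qed

lemma edge_dual_monoid: "\<lbrakk>w \<in> W; S \<subseteq> {..<k}; i < k\<rbrakk> \<Longrightarrow> edge w i \<in> dual_monoid k (cone w S)"
  by (auto simp: dual_monoid_cone edge_ray subset_iff)

lemma uminus_scalar_prod_int:
  assumes "u \<in> carrier_vec k" "x \<in> carrier_vec k"
  shows "(- u) \<bullet> x = - (u \<bullet> (x :: int vec))"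
  using assms by (simp add: scalar_prod_def sum_negf)

text \<open>Together with \<open>edge_dual_monoid\<close> this makes the character of
  \<open>edge w i\<close> a unit on the chart when i is outside \<open>S\<close>.\<close>

lemma uminus_edge_dual_monoid:
  assumes "w \<in> W" "S \<subseteq> {..<k}" "i < k" "i \<notin> S"
  shows "- edge w i \<in> dual_monoid k (cone w S)"
proof -
  have "(- edge w i) \<bullet> ray w j = 0" if "j \<in> S" for j
  proof -
    have "j < k" "i \<noteq> j" using that assms by auto
    moreover from this have "(- edge w i) \<bullet> ray w j = - (edge w i \<bullet> ray w j)"
      using assms by (intro uminus_scalar_prod_int) auto
    ultimately show ?thesis using assms edge_ray[of w i j] by simp
  qed
  then show ?thesis using assms by (simp add: dual_monoid_cone)
qed

text \<open>These differences are the exponents of the monomials that give the projective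
  embedding.\<close>

lemma diff_vertex_dual_monoid:
  assumes "w \<in> W" "\<sigma> \<subseteq> full w" "m \<in> P"
  shows "m - vertex w \<in> dual_monoid k \<sigma>"
proof -
  have "m - vertex w \<in> dual_monoid k (full w)"
    using assms by (simp add: dual_monoid_cone vertex_min minus_carrier_vec)
  then show ?thesis using dual_monoid_anti[OF assms(2)] by blast
qed

lemma lattice_expand:
  assumes "w \<in> W" "r \<in> carrier_vec k" "j < k"
  shows "r $ j = (\<Sum>i<k. (r \<bullet> ray w i) * edge w i $ j)"
proof -
  have "(\<Sum>i<k. (r \<bullet> ray w i) * edge w i $ j)
      = (\<Sum>i<k. \<Sum>l<k. r $ l * (edge w i $ j * ray w i $ l))"
    using assms
    by (intro sum.cong refl)
      (simp add: scalar_prod_carrier[OF ray_carrier] sum_distrib_left mult_ac)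
  also have "\<dots> = (\<Sum>l<k. r $ l * (\<Sum>i<k. edge w i $ j * ray w i $ l))"
    by (subst sum.swap) (simp add: sum_distrib_left)
  also have "\<dots> = (\<Sum>l<k. if j = l then r $ l else 0)"
    using assms by (intro sum.cong refl) (simp add: ray_edge)
  finally show ?thesis using assms(3) by simp
qed

section \<open>Points of a chart as tuples of coordinates\<close>

lemma chart_zero: "\<gamma> \<in> toric_chart k \<sigma> \<Longrightarrow> \<gamma> (0\<^sub>v k) = 1"
  by (simp add: toric_chart_def)

lemma chart_add:
  "\<lbrakk>\<gamma> \<in> toric_chart k \<sigma>; r \<in> dual_monoid k \<sigma>; s \<in> dual_monoid k \<sigma>\<rbrakk> \<Longrightarrow> \<gamma> (r + s) = \<gamma> r * \<gamma> s"
  by (simp add: toric_chart_def)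

lemma chart_unit:
  assumes "\<gamma> \<in> toric_chart k \<sigma>" "r \<in> dual_monoid k \<sigma>" "- r \<in> dual_monoid k \<sigma>"
  shows "\<gamma> r * \<gamma> (- r) = 1"
proof -
  have "r + - r = 0\<^sub>v k" using assms by (auto simp: dual_monoid_def)
  then show ?thesis using chart_add[OF assms] chart_zero[OF assms(1)] by simp
qed

lemma chart_smult:
  assumes "\<sigma> \<subseteq> carrier_vec k" "\<gamma> \<in> toric_chart k \<sigma>" "r \<in> dual_monoid k \<sigma>"
  shows "int n \<cdot>\<^sub>v r \<in> dual_monoid k \<sigma> \<and> \<gamma> (int n \<cdot>\<^sub>v r) = \<gamma> r ^ n"
proof (induction n)
  case 0
  have "int 0 \<cdot>\<^sub>v r = 0\<^sub>v k" using assms(3) by (auto simp: dual_monoid_def)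
  then show ?case using zero_dual_monoid[OF assms(1)] chart_zero[OF assms(2)] by simp
next
  case (Suc n)
  have "int (Suc n) \<cdot>\<^sub>v r = r + int n \<cdot>\<^sub>v r"
    using assms(3) by (auto simp: dual_monoid_def algebra_simps)
  then show ?case
    using Suc add_dual_monoid[OF assms(1,3)] chart_add[OF assms(2,3)] by simp
qed

text \<open>The linear combination is written coordinatewise because the empty sum has to be
  \<open>0\<^sub>v k\<close>, which depends on the dimension.\<close>

lemma chart_sum:
  assumes "\<sigma> \<subseteq> carrier_vec k" "\<gamma> \<in> toric_chart k \<sigma>" "finite I" "\<And>i. i \<in> I \<Longrightarrow> q i \<in> dual_monoid k \<sigma>"
  shows "vec k (\<lambda>j. \<Sum>i\<in>I. int (n i) * q i $ j) \<in> dual_monoid k \<sigma> \<and>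
    \<gamma> (vec k (\<lambda>j. \<Sum>i\<in>I. int (n i) * q i $ j)) = (\<Prod>i\<in>I. \<gamma> (q i) ^ n i)"
  using assms(3,4)
proof (induction I)
  case empty
  have "vec k (\<lambda>j. \<Sum>i\<in>{}. int (n i) * q i $ j) = 0\<^sub>v k" by auto
  then show ?case using zero_dual_monoid[OF assms(1)] chart_zero[OF assms(2)] by simp
next
  case (insert a I)
  have "q a \<in> carrier_vec k" using insert.prems dual_monoid_carrier by blast
  then have e: "vec k (\<lambda>j. \<Sum>i\<in>insert a I. int (n i) * q i $ j)
      = int (n a) \<cdot>\<^sub>v q a + vec k (\<lambda>j. \<Sum>i\<in>I. int (n i) * q i $ j)"
    using insert.hyps by auto
  have "q a \<in> dual_monoid k \<sigma>" using insert.prems by simp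
  note a = chart_smult[OF assms(1,2) this, of "n a"]
  have I: "vec k (\<lambda>j. \<Sum>i\<in>I. int (n i) * q i $ j) \<in> dual_monoid k \<sigma>"
    "\<gamma> (vec k (\<lambda>j. \<Sum>i\<in>I. int (n i) * q i $ j)) = (\<Prod>i\<in>I. \<gamma> (q i) ^ n i)"
    using insert by auto
  show ?case
    unfolding e using add_dual_monoid[OF assms(1) conjunct1[OF a] I(1)]
      chart_add[OF assms(2) conjunct1[OF a] I(1)] a I(2) insert.hyps by simp
qed

text \<open>The character r at the point whose coordinates with respect to \<open>edge w\<close> are
  y. Exponents may be negative; at y i = 0 a negative power takes the default value 0.\<close>

definition torus_monomial :: "'w \<Rightarrow> (nat \<Rightarrow> complex) \<Rightarrow> int vec \<Rightarrow> complex" where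
  "torus_monomial w y r = (\<Prod>i<k. y i powi (r \<bullet> ray w i))"

lemma power_int_mult_power:
  assumes "y \<noteq> 0 \<or> 0 \<le> d"
  shows "y powi d * y ^ nat (- d) = (y :: complex) ^ nat d"
  using assms by (auto simp: power_int_def power_mult_distrib[symmetric])

text \<open>At y = 0 the rule fails for exponents of opposite sign: with exponents 1 and -1 the left
  side is 1 and the right side is 0.\<close>

lemma power_int_add_cases:
  assumes "y \<noteq> 0 \<or> (0 \<le> d \<and> 0 \<le> e)"
  shows "y powi (d + e) = y powi d * (y :: complex) powi e"
  using assms by (cases "y = 0") (auto simp: power_int_add power_int_0_left_if)

text \<open>The chart of \<open>cone w S\<close> is a product of affine lines, one for each index in
  \<open>S\<close>, and punctured lines for the other indices. Here a tuple gives a point;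
  \<open>chart_eq_torus_monomial\<close> recovers the point from its tuple.\<close>

lemma torus_monomial_chart:
  assumes w: "w \<in> W" "S \<subseteq> {..<k}" and y: "\<And>i. i < k \<Longrightarrow> i \<notin> S \<Longrightarrow> y i \<noteq> 0"
  shows "restrict (torus_monomial w y) (dual_monoid k (cone w S)) \<in> toric_chart k (cone w S)"
proof -
  have z: "0\<^sub>v k \<in> dual_monoid k (cone w S)" by (rule zero_dual_monoid[OF cone_carrier])
  have "torus_monomial w y (0\<^sub>v k) = 1"
    using w by (simp add: torus_monomial_def)
  moreover have "torus_monomial w y (r + s) = torus_monomial w y r * torus_monomial w y s"
    if "r \<in> dual_monoid k (cone w S)" "s \<in> dual_monoid k (cone w S)" for r s
    unfolding torus_monomial_def prod.distrib[symmetric]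
  proof (intro prod.cong refl)
    fix i assume "i \<in> {..<k}"
    moreover from this have "(r + s) \<bullet> ray w i = r \<bullet> ray w i + s \<bullet> ray w i"
      using that w by (intro add_scalar_prod_distrib[of _ k]) (auto simp: dual_monoid_def)
    ultimately show "y i powi ((r + s) \<bullet> ray w i) = y i powi (r \<bullet> ray w i) * y i powi (s \<bullet> ray w i)"
      using that y w by (cases "i \<in> S") (auto simp: dual_monoid_cone intro!: power_int_add_cases)
  qed
  ultimately show ?thesis
    using z add_dual_monoid[OF cone_carrier] by (simp add: toric_chart_def)
qed

text \<open>Exponents outside \<open>S\<close> can be negative. Adding their negative parts,
  \<open>?n\<close>, turns r into the combination \<open>?p\<close> with natural coefficients, and
  the added factor cancels because the coordinates outside \<open>S\<close> are units.\<close>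

lemma chart_eq_torus_monomial:
  assumes w: "w \<in> W" "S \<subseteq> {..<k}" and \<gamma>: "\<gamma> \<in> toric_chart k (cone w S)"
    and r: "r \<in> dual_monoid k (cone w S)"
  shows "\<gamma> r = torus_monomial w (\<lambda>i. \<gamma> (edge w i)) r"
proof -
  let ?d = "\<lambda>i. r \<bullet> ray w i" and ?y = "\<lambda>i. \<gamma> (edge w i)"
  let ?p = "vec k (\<lambda>j. \<Sum>i<k. int (nat (?d i)) * edge w i $ j)"
  let ?n = "vec k (\<lambda>j. \<Sum>i<k. int (nat (- ?d i)) * edge w i $ j)"
  have rk: "r \<in> carrier_vec k" using r by (rule dual_monoid_carrier)
  have e: "edge w i \<in> dual_monoid k (cone w S)" if "i \<in> {..<k}" for i
    using edge_dual_monoid[OF w] that by simp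
  note p = chart_sum[OF cone_carrier \<gamma> finite_lessThan e, where n = "\<lambda>i. nat (?d i)"]
  note n = chart_sum[OF cone_carrier \<gamma> finite_lessThan e, where n = "\<lambda>i. nat (- ?d i)"]
  have sum: "r + ?n = ?p"
  proof (rule eq_vecI)
    fix j assume "j < dim_vec ?p"
    then have j: "j < k" by simp
    have "(r + ?n) $ j = r $ j + (\<Sum>i<k. int (nat (- ?d i)) * edge w i $ j)"
      using j rk by simp
    also have "\<dots> = (\<Sum>i<k. (?d i + int (nat (- ?d i))) * edge w i $ j)"
      by (simp add: lattice_expand[OF w(1) rk j] sum.distrib[symmetric] algebra_simps)
    also have "\<dots> = ?p $ j" using j by (auto intro!: sum.cong)
    finally show "(r + ?n) $ j = ?p $ j" .
  qed (use rk in simp)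
  have unit: "?y i \<noteq> 0" if "i < k" "i \<notin> S" for i
    using chart_unit[OF \<gamma> edge_dual_monoid[OF w that(1)] uminus_edge_dual_monoid[OF w that]]
    by auto
  have or: "?y i \<noteq> 0 \<or> 0 \<le> ?d i" if "i < k" for i
    using that unit r by (cases "i \<in> S") (auto simp: dual_monoid_cone[OF w])
  have "\<gamma> r * (\<Prod>i<k. ?y i ^ nat (- ?d i)) = \<gamma> r * \<gamma> ?n"
    by (simp only: conjunct2[OF n])
  also have "\<dots> = \<gamma> ?p"
    by (simp only: chart_add[OF \<gamma> r conjunct1[OF n], symmetric] sum)
  also have "\<dots> = (\<Prod>i<k. ?y i ^ nat (?d i))"
    by (simp only: conjunct2[OF p])
  also have "\<dots> = torus_monomial w ?y r * (\<Prod>i<k. ?y i ^ nat (- ?d i))"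
    unfolding torus_monomial_def prod.distrib[symmetric]
    by (intro prod.cong refl, rule power_int_mult_power[symmetric]) (use or in auto)
  finally show ?thesis
    using or by (subst (asm) mult_right_cancel) (fastforce simp: prod_zero_iff)+
qed

lemma chart_eqI:
  assumes w: "w \<in> W" "S \<subseteq> {..<k}" and "\<gamma> \<in> toric_chart k (cone w S)" "\<delta> \<in> toric_chart k (cone w S)"
    and "\<And>i. i < k \<Longrightarrow> \<gamma> (edge w i) = \<delta> (edge w i)"
  shows "\<gamma> = \<delta>"
proof (rule extensionalityI[of _ "dual_monoid k (cone w S)"])
  show "\<gamma> r = \<delta> r" if "r \<in> dual_monoid k (cone w S)" for r
    using chart_eq_torus_monomial[OF w assms(3) that] chart_eq_torus_monomial[OF w assms(4) that]
      assms(5) by (simp add: torus_monomial_def)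
qed (use assms in \<open>auto simp: toric_chart_def\<close>)

text \<open>Passing to the face spanned by \<open>T\<close> is localisation at the coordinates of
  \<open>S - T\<close>; a point extends once these are invertible.\<close>

lemma chart_extend:
  assumes w: "w \<in> W" "S \<subseteq> {..<k}" "T \<subseteq> S" and \<gamma>: "\<gamma> \<in> toric_chart k (cone w S)"
    and nz: "\<And>i. i \<in> S - T \<Longrightarrow> \<gamma> (edge w i) \<noteq> 0"
  shows "\<exists>\<delta>\<in>toric_chart k (cone w T). \<gamma> = restrict \<delta> (dual_monoid k (cone w S))"
proof
  let ?y = "\<lambda>i. \<gamma> (edge w i)"
  have Tk: "T \<subseteq> {..<k}" using w by auto
  have sub: "dual_monoid k (cone w S) \<subseteq> dual_monoid k (cone w T)"
    by (rule dual_monoid_anti[OF cone_mono[OF w(1,3,2)]])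
  have "?y i \<noteq> 0" if "i < k" "i \<notin> T" for i
  proof (cases "i \<in> S")
    case False
    then show ?thesis
      using chart_unit[OF \<gamma> edge_dual_monoid[OF w(1,2) that(1)]
        uminus_edge_dual_monoid[OF w(1,2) that(1)]] by auto
  qed (use nz that in auto)
  then show "restrict (torus_monomial w ?y) (dual_monoid k (cone w T)) \<in> toric_chart k (cone w T)"
    by (rule torus_monomial_chart[OF w(1) Tk])
  have "\<gamma> = restrict (torus_monomial w ?y) (dual_monoid k (cone w S))"
    using \<gamma> chart_eq_torus_monomial[OF w(1,2) \<gamma>]
    by (intro extensionalityI[of _ "dual_monoid k (cone w S)"]) (auto simp: toric_chart_def)
  also have "\<dots> = restrict (restrict (torus_monomial w ?y) (dual_monoid k (cone w T)))
      (dual_monoid k (cone w S))"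
    using sub by (auto simp: restrict_def fun_eq_iff)
  finally show "\<gamma> = restrict (restrict (torus_monomial w ?y) (dual_monoid k (cone w T)))
      (dual_monoid k (cone w S))" .
qed

end

section \<open>Gluing and homogeneous coordinates\<close>

definition line :: "complex vec \<Rightarrow> complex vec set" where
  "line v = {t \<cdot>\<^sub>v v | t. t \<noteq> 0}"

lemma line_eq_iff:
  "line v = line v' \<longleftrightarrow> (\<exists>t. t \<noteq> 0 \<and> v' = t \<cdot>\<^sub>v v)"
proof
  have "v' = 1 \<cdot>\<^sub>v v'" by simp
  then have "v' \<in> line v'" unfolding line_def by (metis (mono_tags, lifting) mem_Collect_eq zero_neq_one)
  moreover assume "line v = line v'"
  ultimately show "\<exists>t. t \<noteq> 0 \<and> v' = t \<cdot>\<^sub>v v" by (auto simp: line_def)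
next
  assume "\<exists>t. t \<noteq> 0 \<and> v' = t \<cdot>\<^sub>v v"
  then obtain t where t: "t \<noteq> 0" "v' = t \<cdot>\<^sub>v v" by blast
  show "line v = line v'"
    unfolding line_def t(2) smult_smult_assoc
  proof (intro subset_antisym subsetI; clarify)
    fix s :: complex assume "s \<noteq> 0"
    then show "\<exists>t'. s \<cdot>\<^sub>v v = (t' * t) \<cdot>\<^sub>v v \<and> t' \<noteq> 0"
      using t by (intro exI[of _ "s / t"]) simp
  next
    fix s :: complex assume "s \<noteq> 0"
    then show "\<exists>t'. (s * t) \<cdot>\<^sub>v v = t' \<cdot>\<^sub>v v \<and> t' \<noteq> 0"
      using t by (intro exI[of _ "s * t"]) simp
  qed
qed

lemma line_self: "v \<in> line v"
  unfolding line_def by (intro CollectI exI[of _ 1]) simp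

lemma mem_line: "v' \<in> line v \<Longrightarrow> line v' = line v"
  using line_eq_iff[of v v'] by (auto simp: line_def)

lemma proj_points_line:
  "proj_points N = line ` (carrier_vec (Suc N) - {0\<^sub>v (Suc N)})"
  by (simp add: proj_points_def line_def)

context smooth_polytope
begin

section \<open>Homogeneous coordinates indexed by the polytope\<close>

definition N :: nat where
  "N = card P - 1"

definition enum :: "nat \<Rightarrow> int vec" where
  "enum = (SOME h. bij_betw h {..N} P)"

definition coord :: "complex vec \<Rightarrow> int vec \<Rightarrow> complex" where
  "coord v m = v $ (inv_into {..N} enum m)"

lemma enum: "bij_betw enum {..N} P"
proof -
  have "P \<noteq> {}" using W_nonempty vertex_P by auto
  then have "card P = Suc N" using finite_P by (simp add: N_def card_gt_0_iff)
  then have "{..N} = {0..<card P}" by auto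
  then have "\<exists>h. bij_betw h {..N} P" using ex_bij_betw_nat_finite[OF finite_P] by simp
  then show ?thesis unfolding enum_def by (rule someI_ex)
qed

lemma enum_inv:
  assumes "m \<in> P"
  shows "inv_into {..N} enum m \<le> N" "enum (inv_into {..N} enum m) = m"
  using assms enum f_inv_into_f[of m enum "{..N}"] inv_into_into[of m enum "{..N}"]
  by (simp_all add: bij_betw_def)

lemma enum_P: "i \<le> N \<Longrightarrow> enum i \<in> P"
  using bij_betwE[OF enum] by simp

lemma coord_enum: "i \<le> N \<Longrightarrow> coord v (enum i) = v $ i"
  using enum bij_betw_inv_into_left[of enum "{..N}" P i] by (simp add: coord_def)

lemma coord_eqI:
  assumes "v \<in> carrier_vec (Suc N)" "v' \<in> carrier_vec (Suc N)" "\<And>m. m \<in> P \<Longrightarrow> coord v m = coord v' m"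
  shows "v = v'"
proof (rule eq_vecI)
  fix i assume "i < dim_vec v'"
  then have "i \<le> N" using assms by simp
  then show "v $ i = v' $ i" using assms(3)[OF enum_P] by (simp add: coord_enum)
qed (use assms in simp)

lemma coord_smult: "\<lbrakk>v \<in> carrier_vec (Suc N); m \<in> P\<rbrakk> \<Longrightarrow> coord (t \<cdot>\<^sub>v v) m = t * coord v m"
  using enum_inv(1)[of m] by (simp add: coord_def)

text \<open>Shifting by \<open>vertex w\<close> brings all exponents into the dual monoid and
  normalises the coordinate at \<open>vertex w\<close> to 1.\<close>

definition hom_coords :: "'w \<Rightarrow> (int vec \<Rightarrow> complex) \<Rightarrow> complex vec" where
  "hom_coords w \<gamma> = vec (Suc N) (\<lambda>i. \<gamma> (enum i - vertex w))"

lemma hom_coords_carrier [simp]: "hom_coords w \<gamma> \<in> carrier_vec (Suc N)"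
  by (simp add: hom_coords_def)

lemma coord_hom_coords: "m \<in> P \<Longrightarrow> coord (hom_coords w \<gamma>) m = \<gamma> (m - vertex w)"
  using enum_inv[of m] by (simp add: coord_def hom_coords_def)

lemma vertex_cancel [simp]: "w \<in> W \<Longrightarrow> vertex w - vertex w = 0\<^sub>v k"
  by (intro eq_vecI) auto

lemma coord_hom_coords_vertex:
  "\<lbrakk>w \<in> W; \<gamma> \<in> toric_chart k \<sigma>\<rbrakk> \<Longrightarrow> coord (hom_coords w \<gamma>) (vertex w) = 1"
  using chart_zero[of \<gamma> \<sigma>] by (simp add: coord_hom_coords vertex_P minus_cancel_vec[of _ k])

lemma line_hom_coords_proj:
  assumes "w \<in> W" "\<gamma> \<in> toric_chart k \<sigma>"
  shows "line (hom_coords w \<gamma>) \<in> proj_points N"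
proof -
  have "hom_coords w \<gamma> \<noteq> 0\<^sub>v (Suc N)"
    using coord_hom_coords_vertex[OF assms] enum_inv[OF vertex_P[OF assms(1)]]
    by (auto simp: coord_def)
  then show ?thesis unfolding proj_points_line by simp
qed

text \<open>Any vertex whose full cone contains \<sigma> gives the same line, see
  \<open>line_hom_coords_cong\<close>; the choice makes the value depend on the chart alone.\<close>

definition point :: "real vec set \<Rightarrow> (int vec \<Rightarrow> complex) \<Rightarrow> complex vec set" where
  "point \<sigma> \<gamma> = line (hom_coords (SOME w. w \<in> W \<and> \<sigma> \<subseteq> full w) \<gamma>)"

lemma normal_fanE:
  assumes "\<sigma> \<in> normal_fan"
  obtains w S where "w \<in> W" "S \<subseteq> {..<k}" "\<sigma> = cone w S" "\<sigma> \<subseteq> full w"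
  using assms cone_mono unfolding normal_fan_def by blast

lemma full_normal_fan: "w \<in> W \<Longrightarrow> full w \<in> normal_fan"
  by (auto simp: normal_fan_def)

lemma chart_diff:
  assumes "w \<in> W" "w' \<in> W" "\<sigma> \<subseteq> full w" "\<sigma> \<subseteq> full w'" "\<gamma> \<in> toric_chart k \<sigma>" "m \<in> P"
  shows "\<gamma> (m - vertex w') = \<gamma> (vertex w - vertex w') * \<gamma> (m - vertex w)"
proof -
  have "m - vertex w' = (vertex w - vertex w') + (m - vertex w)"
    using assms by (intro eq_vecI) auto
  then show ?thesis
    using assms chart_add[OF assms(5)] diff_vertex_dual_monoid vertex_P by metis
qed

text \<open>Changing the vertex multiplies all coordinates by the value of \<gamma> at
  \<open>vertex w - vertex w'\<close>, which is nonzero because the opposite difference lies in the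
  dual monoid too.\<close>

lemma line_hom_coords_cong:
  assumes "w \<in> W" "w' \<in> W" "\<sigma> \<subseteq> full w" "\<sigma> \<subseteq> full w'" "\<gamma> \<in> toric_chart k \<sigma>"
  shows "line (hom_coords w \<gamma>) = line (hom_coords w' \<gamma>)"
proof -
  let ?t = "\<gamma> (vertex w - vertex w')"
  have "\<gamma> (vertex w' - vertex w') = ?t * \<gamma> (vertex w' - vertex w)"
    using assms by (intro chart_diff) (auto simp: vertex_P)
  then have "?t \<noteq> 0"
    using assms chart_zero[OF assms(5)] minus_cancel_vec[OF vertex_carrier[OF assms(2)]] by auto
  moreover have "hom_coords w' \<gamma> = ?t \<cdot>\<^sub>v hom_coords w \<gamma>"
    using chart_diff[OF assms]
    by (intro coord_eqI) (auto simp: coord_smult coord_hom_coords)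
  ultimately show ?thesis unfolding line_eq_iff by blast
qed

lemma point_eq:
  assumes "w \<in> W" "\<sigma> \<subseteq> full w" "\<gamma> \<in> toric_chart k \<sigma>"
  shows "point \<sigma> \<gamma> = line (hom_coords w \<gamma>)"
proof -
  have "(SOME w. w \<in> W \<and> \<sigma> \<subseteq> full w) \<in> W \<and> \<sigma> \<subseteq> full (SOME w. w \<in> W \<and> \<sigma> \<subseteq> full w)"
    by (rule someI[of _ w]) (use assms in simp)
  then show ?thesis unfolding point_def using assms by (intro line_hom_coords_cong) auto
qed

lemma hom_coords_restrict:
  assumes "w \<in> W" "\<sigma> \<subseteq> full w"
  shows "hom_coords w (restrict \<delta> (dual_monoid k \<sigma>)) = hom_coords w \<delta>"
  using diff_vertex_dual_monoid[OF assms]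
  by (intro coord_eqI) (auto simp: coord_hom_coords)

section \<open>Gluing as equality of images\<close>

text \<open>
  If the \<open>i\<close>-th affine coordinate of a point vanishes in the chart of \<open>w\<close>, then every
  nonzero homogeneous coordinate belongs to the facet of \<open>P\<close> with normal \<open>ray w i\<close>; in
  particular the one at \<open>vertex w'\<close> does.
\<close>

lemma vanishing_ray_mem:
  assumes w: "w \<in> W" "S \<subseteq> {..<k}" and w': "w' \<in> W" "S' \<subseteq> {..<k}"
    and \<gamma>: "\<gamma> \<in> toric_chart k (cone w S)" and \<gamma>': "\<gamma>' \<in> toric_chart k (cone w' S')"
    and eq: "line (hom_coords w \<gamma>) = line (hom_coords w' \<gamma>')"
    and i: "i < k" "\<gamma> (edge w i) = 0"
  shows "rray w i \<in> cone w' S'"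
proof -
  obtain t where t: "t \<noteq> 0" "hom_coords w' \<gamma>' = t \<cdot>\<^sub>v hom_coords w \<gamma>"
    using eq by (auto simp: line_eq_iff)
  have t': "\<gamma>' (m - vertex w') = t * \<gamma> (m - vertex w)" if "m \<in> P" for m
    using coord_hom_coords[OF that, of w' \<gamma>'] that by (simp add: t(2) coord_smult coord_hom_coords)
  have facet: "m \<bullet> ray w i = vertex w \<bullet> ray w i"
    if m: "m \<in> P" "\<gamma>' (m - vertex w') \<noteq> 0" for m
  proof -
    have "\<gamma> (m - vertex w) \<noteq> 0" using t' m by auto
    moreover have "\<gamma> (m - vertex w) = torus_monomial w (\<lambda>i. \<gamma> (edge w i)) (m - vertex w)"
      using diff_vertex_dual_monoid[OF w(1) cone_mono[OF w subset_refl] m(1)]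
      by (rule chart_eq_torus_monomial[OF w \<gamma>])
    ultimately have "0 powi ((m - vertex w) \<bullet> ray w i) \<noteq> (0 :: complex)"
      using i by (auto simp: torus_monomial_def)
    then have "(m - vertex w) \<bullet> ray w i = 0" by (auto simp: power_int_0_left_if split: if_splits)
    then show ?thesis
      using minus_scalar_prod_distrib[of m k "vertex w" "ray w i"] m w i by simp
  qed
  have rk: "ray w i \<in> carrier_vec k" using w i by simp
  have v': "vertex w' \<bullet> ray w i = vertex w \<bullet> ray w i"
    using facet[OF vertex_P[OF w'(1)]] w' chart_zero[OF \<gamma>'] by simp
  have "vertex w' \<bullet> ray w i \<le> m \<bullet> ray w i" if "m \<in> P" for m
    using vertex_min[OF w(1) i(1) that] minus_scalar_prod_distrib[of m k "vertex w" "ray w i"]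
      that w rk v' by simp
  then have full: "rray w i \<in> full w'"
    using w' rk by (simp add: mem_full_cone of_lattice_scalar_prod[of _ k])
  \<comment> \<open>A coordinate outside \<open>S'\<close> is a unit on the chart of \<gamma>', so
    \<open>vertex w' + edge w' j\<close> lies on the facet as well; the edge leading to it is then
    orthogonal to \<open>ray w i\<close>.\<close>
  have "coef w' j (rray w i) = 0" if j: "j < k" "j \<notin> S'" for j
  proof -
    have e: "vertex w' + edge w' j \<in> P" using edge_P[OF w'(1) j(1)] .
    have "(vertex w' + edge w' j) - vertex w' = edge w' j"
      using w' j by (intro eq_vecI) auto
    moreover have "\<gamma>' (edge w' j) \<noteq> 0"
      using chart_unit[OF \<gamma>' edge_dual_monoid[OF w' j(1)] uminus_edge_dual_monoid[OF w' j]] by auto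
    ultimately have "(vertex w' + edge w' j) \<bullet> ray w i = vertex w \<bullet> ray w i"
      using facet[OF e] by simp
    then have "edge w' j \<bullet> ray w i = 0"
      using v' add_scalar_prod_distrib[of "vertex w'" k "edge w' j" "ray w i"] w' j rk by simp
    then show ?thesis using w' j rk by (simp add: coef_def of_lattice_scalar_prod[of _ k])
  qed
  then show ?thesis using full unfolding mem_cone[OF w'] mem_cone[OF w'(1) subset_refl] by auto
qed

text \<open>By \<open>vanishing_ray_mem\<close> the affine coordinates of \<gamma> at rays outside
  the intersection do not vanish, which is what \<open>chart_extend\<close> asks for.\<close>

lemma chart_extend_inter:
  assumes w: "w \<in> W" "S \<subseteq> {..<k}" and w': "w' \<in> W" "S' \<subseteq> {..<k}"
    and \<gamma>: "\<gamma> \<in> toric_chart k (cone w S)" and \<gamma>': "\<gamma>' \<in> toric_chart k (cone w' S')"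
    and eq: "line (hom_coords w \<gamma>) = line (hom_coords w' \<gamma>')"
  shows "\<exists>\<delta>\<in>toric_chart k (cone w S \<inter> cone w' S'). \<gamma> = restrict \<delta> (dual_monoid k (cone w S))"
  unfolding cone_inter[OF w w']
proof (rule chart_extend[OF w _ \<gamma>])
  fix i assume "i \<in> S - {i \<in> S. rray w i \<in> cone w' S'}"
  then show "\<gamma> (edge w i) \<noteq> 0"
    using vanishing_ray_mem[OF w w' \<gamma> \<gamma>' eq, of i] w by auto
qed auto

text \<open>This exhibits gluing as the kernel of the map to projective space, so gluing classes are
  fibres of that map. If the images agree, both points extend to the chart of the intersection, and
  there the extensions coincide.\<close>

lemma gluing_eq:
  "gluing k normal_fan = {((\<sigma>, \<gamma>), (\<sigma>', \<gamma>')). \<sigma> \<in> normal_fan \<and> \<sigma>' \<in> normal_fan \<and>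
     \<gamma> \<in> toric_chart k \<sigma> \<and> \<gamma>' \<in> toric_chart k \<sigma>' \<and> point \<sigma> \<gamma> = point \<sigma>' \<gamma>'}"
proof -
  have "(\<exists>\<delta>\<in>toric_chart k (\<sigma> \<inter> \<sigma>'). \<gamma> = restrict \<delta> (dual_monoid k \<sigma>) \<and>
      \<gamma>' = restrict \<delta> (dual_monoid k \<sigma>')) \<longleftrightarrow> point \<sigma> \<gamma> = point \<sigma>' \<gamma>'" (is "?L \<longleftrightarrow> ?R")
    if fan: "\<sigma> \<in> normal_fan" "\<sigma>' \<in> normal_fan"
      and \<gamma>: "\<gamma> \<in> toric_chart k \<sigma>" and \<gamma>': "\<gamma>' \<in> toric_chart k \<sigma>'" for \<sigma> \<sigma>' \<gamma> \<gamma>'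
  proof -
    obtain w S where w: "w \<in> W" "S \<subseteq> {..<k}" and \<sigma>: "\<sigma> = cone w S" "\<sigma> \<subseteq> full w"
      using fan(1) by (rule normal_fanE)
    obtain w' S' where w': "w' \<in> W" "S' \<subseteq> {..<k}" and \<sigma>': "\<sigma>' = cone w' S'" "\<sigma>' \<subseteq> full w'"
      using fan(2) by (rule normal_fanE)
    note pe = point_eq[OF w(1) \<sigma>(2) \<gamma>] point_eq[OF w'(1) \<sigma>'(2) \<gamma>']
    show ?thesis
    proof
      assume ?L
      then obtain \<delta> where \<delta>: "\<delta> \<in> toric_chart k (\<sigma> \<inter> \<sigma>')"
        "\<gamma> = restrict \<delta> (dual_monoid k \<sigma>)" "\<gamma>' = restrict \<delta> (dual_monoid k \<sigma>')" by blast
      then have "line (hom_coords w \<delta>) = line (hom_coords w' \<delta>)"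
        using \<sigma>(2) \<sigma>'(2) w w' by (intro line_hom_coords_cong[OF _ _ _ _ \<delta>(1)]) auto
      then show ?R
        unfolding pe using \<delta> \<sigma> \<sigma>' w w' by (simp add: hom_coords_restrict)
    next
      assume ?R
      then have eq: "line (hom_coords w \<gamma>) = line (hom_coords w' \<gamma>')" unfolding pe .
      then obtain t where t: "t \<noteq> 0" "hom_coords w' \<gamma>' = t \<cdot>\<^sub>v hom_coords w \<gamma>"
        by (auto simp: line_eq_iff)
      have t': "\<gamma>' (m - vertex w') = t * \<gamma> (m - vertex w)" if "m \<in> P" for m
        using coord_hom_coords[OF that, of w' \<gamma>'] that
        by (simp add: t(2) coord_smult coord_hom_coords)
      obtain \<delta> where \<delta>: "\<delta> \<in> toric_chart k (\<sigma> \<inter> \<sigma>')" "\<gamma> = restrict \<delta> (dual_monoid k \<sigma>)"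
        using chart_extend_inter[OF w w' _ _ eq] \<gamma> \<gamma>' \<sigma> \<sigma>' by auto
      obtain \<delta>' where \<delta>': "\<delta>' \<in> toric_chart k (\<sigma> \<inter> \<sigma>')" "\<gamma>' = restrict \<delta>' (dual_monoid k \<sigma>')"
        using chart_extend_inter[OF w' w _ _ eq[symmetric]] \<gamma> \<gamma>' \<sigma> \<sigma>' by (auto simp: Int_commute)
      have sub: "\<sigma> \<inter> \<sigma>' \<subseteq> full w" "\<sigma> \<inter> \<sigma>' \<subseteq> full w'" using \<sigma> \<sigma>' by auto
      let ?T = "{i \<in> S. rray w i \<in> cone w' S'}"
      have T: "?T \<subseteq> {..<k}" using w by auto
      \<comment> \<open>Compare the homogeneous coordinates at \<open>vertex w\<close> and at its
        neighbour: the value of \<delta>' at \<open>vertex w - vertex w'\<close> is the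
        proportionality factor t, which cancels.\<close>
      have "\<delta> (edge w i) = \<delta>' (edge w i)" if i: "i < k" for i
      proof -
        have e: "vertex w + edge w i \<in> P" using edge_P[OF w(1) i] .
        have ve: "(vertex w + edge w i) - vertex w = edge w i"
          using w i by (intro eq_vecI) auto
        have 1: "\<delta> (edge w i) = \<gamma> (edge w i)"
          using edge_dual_monoid[OF w i] by (simp add: \<delta>(2) \<sigma>(1))
        have in': "m - vertex w' \<in> dual_monoid k \<sigma>'" if "m \<in> P" for m
          using diff_vertex_dual_monoid[OF w'(1) \<sigma>'(2) that] .
        have "\<delta>' ((vertex w + edge w i) - vertex w') = \<delta>' (vertex w - vertex w') * \<delta>' (edge w i)"
          using chart_diff[OF w(1) w'(1) sub \<delta>'(1) e] unfolding ve .
        moreover have "\<delta>' ((vertex w + edge w i) - vertex w') = t * \<gamma> (edge w i)"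
          using t'[OF e] in'[OF e] unfolding ve by (simp add: \<delta>'(2))
        moreover have "\<delta>' (vertex w - vertex w') = t"
          using t'[OF vertex_P[OF w(1)]] in'[OF vertex_P[OF w(1)]] w chart_zero[OF \<gamma>]
          by (simp add: \<delta>'(2))
        ultimately show ?thesis using 1 t by simp
      qed
      then have "\<delta> = \<delta>'"
        using \<delta>(1) \<delta>'(1) unfolding \<sigma>(1) \<sigma>'(1) cone_inter[OF w w'] by (intro chart_eqI[OF w(1) T])
      then show ?L using \<delta> \<delta>' by blast
    qed
  qed
  then show ?thesis unfolding gluing_def by blast
qed

end

section \<open>The image in projective space\<close>

text \<open>\<open>hom_poly\<close> sums over a set of exponents, so terms of an indexed sum that
  share an exponent have to be collected.\<close>

lemma hom_polyI:
  assumes "finite I" "\<And>x. x \<in> I \<Longrightarrow> (\<Sum>i\<le>N. e x i) = d"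
  shows "hom_poly N d (\<lambda>v. \<Sum>x\<in>I. a x * (\<Prod>i\<le>N. (v $ i) ^ e x i))"
  unfolding hom_poly_def
proof (intro exI conjI ext)
  show "finite (e ` I)" "\<forall>\<alpha>\<in>e ` I. (\<Sum>i\<le>N. \<alpha> i) = d" using assms by auto
  fix v :: "complex vec"
  have "(\<Sum>x\<in>I. a x * (\<Prod>i\<le>N. (v $ i) ^ e x i))
      = (\<Sum>\<alpha>\<in>e ` I. \<Sum>x\<in>{x \<in> I. e x = \<alpha>}. a x * (\<Prod>i\<le>N. (v $ i) ^ e x i))"
    by (rule sum.image_gen[OF assms(1)])
  also have "\<dots> = (\<Sum>\<alpha>\<in>e ` I. (\<Sum>x\<in>{x \<in> I. e x = \<alpha>}. a x) * (\<Prod>i\<le>N. (v $ i) ^ \<alpha> i))"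
    by (simp add: sum_distrib_right)
  finally show "(\<Sum>x\<in>I. a x * (\<Prod>i\<le>N. (v $ i) ^ e x i))
      = (\<Sum>\<alpha>\<in>e ` I. (\<Sum>x\<in>{x \<in> I. e x = \<alpha>}. a x) * (\<Prod>i\<le>N. (v $ i) ^ \<alpha> i))" .
qed

lemma hom_poly_zero: "hom_poly N d (\<lambda>v. 0)"
  using hom_polyI[of "{}" undefined N d undefined] by simp

lemma hom_poly_const: "hom_poly N 0 (\<lambda>v. c)"
  using hom_polyI[of "{()}" "\<lambda>_ _. 0" N 0 "\<lambda>_. c"] by simp

lemma hom_poly_coord:
  assumes "i \<le> N"
  shows "hom_poly N 1 (\<lambda>v. v $ i)"
proof -
  have "(\<Prod>j\<le>N. (v $ j) ^ (if j = i then 1 else 0)) = v $ i" for v :: "complex vec"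
  proof -
    have "(\<Prod>j\<le>N. (v $ j) ^ (if j = i then 1 else 0)) = (\<Prod>j\<le>N. if j = i then v $ j else 1)"
      by (intro prod.cong) auto
    then show ?thesis using assms by simp
  qed
  then show ?thesis
    using hom_polyI[of "{()}" "\<lambda>_ j. if j = i then 1 else 0" N 1 "\<lambda>_. 1"] assms by simp
qed

lemma hom_poly_add:
  assumes "hom_poly N d F" "hom_poly N d G"
  shows "hom_poly N d (\<lambda>v. F v + G v)"
proof -
  obtain E a where E: "finite E" "\<forall>\<alpha>\<in>E. (\<Sum>i\<le>N. \<alpha> i) = d"
    "F = (\<lambda>v. \<Sum>\<alpha>\<in>E. a \<alpha> * (\<Prod>i\<le>N. (v $ i) ^ \<alpha> i))"
    using assms(1) by (auto simp: hom_poly_def)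
  obtain E' a' where E': "finite E'" "\<forall>\<alpha>\<in>E'. (\<Sum>i\<le>N. \<alpha> i) = d"
    "G = (\<lambda>v. \<Sum>\<alpha>\<in>E'. a' \<alpha> * (\<Prod>i\<le>N. (v $ i) ^ \<alpha> i))"
    using assms(2) by (auto simp: hom_poly_def)
  have "(\<Sum>i\<le>N. case_sum id id x i) = d" if "x \<in> E <+> E'" for x
    using that E E' by auto
  then show ?thesis
    using hom_polyI[of "E <+> E'" "case_sum id id" N d "case_sum a a'"] E E'
    by (simp add: sum.Plus)
qed

lemma hom_poly_mult:
  assumes "hom_poly N d F" "hom_poly N d' G"
  shows "hom_poly N (d + d') (\<lambda>v. F v * G v)"
proof -
  obtain E a where E: "finite E" "\<forall>\<alpha>\<in>E. (\<Sum>i\<le>N. \<alpha> i) = d"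
    "F = (\<lambda>v. \<Sum>\<alpha>\<in>E. a \<alpha> * (\<Prod>i\<le>N. (v $ i) ^ \<alpha> i))"
    using assms(1) by (auto simp: hom_poly_def)
  obtain E' a' where E': "finite E'" "\<forall>\<alpha>\<in>E'. (\<Sum>i\<le>N. \<alpha> i) = d'"
    "G = (\<lambda>v. \<Sum>\<alpha>\<in>E'. a' \<alpha> * (\<Prod>i\<le>N. (v $ i) ^ \<alpha> i))"
    using assms(2) by (auto simp: hom_poly_def)
  have "hom_poly N (d + d') (\<lambda>v. \<Sum>x\<in>E \<times> E'. (a (fst x) * a' (snd x)) *
      (\<Prod>i\<le>N. (v $ i) ^ (fst x i + snd x i)))"
    using E E' by (intro hom_polyI) (auto simp: sum.distrib)
  moreover have "F v * G v = (\<Sum>x\<in>E \<times> E'. (a (fst x) * a' (snd x)) *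
      (\<Prod>i\<le>N. (v $ i) ^ (fst x i + snd x i)))" for v
    unfolding E(3) E'(3) sum_product sum.cartesian_product
    by (intro sum.cong refl) (auto simp: power_add prod.distrib)
  ultimately show ?thesis by simp
qed

lemma hom_poly_diff:
  assumes "hom_poly N d F" "hom_poly N d G"
  shows "hom_poly N d (\<lambda>v. F v - G v)"
  using hom_poly_add[OF assms(1), of "\<lambda>v. - G v"]
    hom_poly_mult[OF hom_poly_const[of N "-1"] assms(2)] by simp

lemma hom_poly_power: "hom_poly N d F \<Longrightarrow> hom_poly N (n * d) (\<lambda>v. F v ^ n)"
proof (induction n)
  case 0
  then show ?case using hom_poly_const[of N 1] by simp
next
  case (Suc n)
  then show ?case using hom_poly_mult[of N d F "n * d" "\<lambda>v. F v ^ n"] by simp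
qed

lemma hom_poly_prod:
  assumes "finite I" "\<And>i. i \<in> I \<Longrightarrow> hom_poly N (d i) (F i)"
  shows "hom_poly N (\<Sum>i\<in>I. d i) (\<lambda>v. \<Prod>i\<in>I. F i v)"
  using assms
proof (induction I)
  case empty
  then show ?case using hom_poly_const[of N 1] by simp
next
  case (insert i I)
  then show ?case using hom_poly_mult[of N "d i" "F i"] by simp
qed

lemma hom_poly_sum:
  assumes "finite I" "\<And>i. i \<in> I \<Longrightarrow> hom_poly N d (F i)"
  shows "hom_poly N d (\<lambda>v. \<Sum>i\<in>I. F i v)"
  using assms
proof (induction I)
  case empty
  then show ?case using hom_poly_zero[of N d] by simp
next
  case (insert i I)
  then show ?case using hom_poly_add[of N d "F i"] by simp
qed

lemma hom_poly_smult:
  assumes "hom_poly N d F" "v \<in> carrier_vec (Suc N)"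
  shows "F (t \<cdot>\<^sub>v v) = t ^ d * F v"
proof -
  obtain E a where E: "finite E" "\<forall>\<alpha>\<in>E. (\<Sum>i\<le>N. \<alpha> i) = d"
    "F = (\<lambda>v. \<Sum>\<alpha>\<in>E. a \<alpha> * (\<Prod>i\<le>N. (v $ i) ^ \<alpha> i))"
    using assms(1) by (auto simp: hom_poly_def)
  have "(\<Prod>i\<le>N. ((t \<cdot>\<^sub>v v) $ i) ^ \<alpha> i) = t ^ d * (\<Prod>i\<le>N. (v $ i) ^ \<alpha> i)" if "\<alpha> \<in> E" for \<alpha>
  proof -
    have "(\<Prod>i\<le>N. ((t \<cdot>\<^sub>v v) $ i) ^ \<alpha> i) = (\<Prod>i\<le>N. t ^ \<alpha> i * (v $ i) ^ \<alpha> i)"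
      using assms(2) by (intro prod.cong) (auto simp: power_mult_distrib)
    also have "\<dots> = t ^ (\<Sum>i\<le>N. \<alpha> i) * (\<Prod>i\<le>N. (v $ i) ^ \<alpha> i)"
      by (simp add: prod.distrib power_sum)
    finally show ?thesis using E(2) that by simp
  qed
  then show ?thesis unfolding E(3) by (simp add: sum_distrib_left mult_ac)
qed

lemma hom_poly_line:
  assumes "hom_poly N d F" "v \<in> carrier_vec (Suc N)" "v' \<in> line v"
  shows "F v' = 0 \<longleftrightarrow> F v = 0"
  using assms(3) hom_poly_smult[OF assms(1,2)] by (auto simp: line_def)

lemma proj_pointsE:
  assumes "p \<in> proj_points N" "v \<in> p"
  shows "p = line v" "v \<in> carrier_vec (Suc N)" "v \<noteq> 0\<^sub>v (Suc N)"
proof -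
  obtain u where u: "u \<in> carrier_vec (Suc N)" "u \<noteq> 0\<^sub>v (Suc N)" "p = line u"
    using assms(1) unfolding proj_points_line by auto
  then obtain t where t: "t \<noteq> 0" "v = t \<cdot>\<^sub>v u" using assms(2) by (auto simp: line_def)
  show "p = line v" using mem_line[of v u] assms u by simp
  show "v \<in> carrier_vec (Suc N)" using t u by simp
  have "u = (1 / t) \<cdot>\<^sub>v v" using t by (simp add: smult_smult_assoc)
  then show "v \<noteq> 0\<^sub>v (Suc N)" using u by auto
qed

lemma topspace_proj_zariski: "topspace (proj_zariski N) = proj_points N"
  unfolding proj_zariski_def topology_generated_by_topspace
proof (intro subset_antisym subsetI)
  fix p assume "p \<in> proj_points N"
  then show "p \<in> \<Union> {{p \<in> proj_points N. \<forall>v\<in>p. F v \<noteq> 0} | d F. hom_poly N d F}"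
    by (intro UnionI[of "{p \<in> proj_points N. \<forall>v\<in>p. (\<lambda>v. 1 :: complex) v \<noteq> 0}"] CollectI
        exI[of _ 0] exI[of _ "\<lambda>v. 1"]) (simp_all add: hom_poly_const)
qed auto

lemma openin_proj_zariski:
  "hom_poly N d F \<Longrightarrow> openin (proj_zariski N) {p \<in> proj_points N. \<forall>v\<in>p. F v \<noteq> 0}"
  unfolding proj_zariski_def by (rule topology_generated_by_Basis) blast

text \<open>Around each point of the complement a single polynomial of \<open>E\<close> that is
  nonzero there gives an open neighbourhood, whatever the size of \<open>E\<close>.\<close>

lemma closedin_hom_zeros:
  assumes "\<And>F. F \<in> E \<Longrightarrow> \<exists>d. hom_poly N d F"
  shows "closedin (proj_zariski N) {p \<in> proj_points N. \<forall>v\<in>p. \<forall>F\<in>E. F v = 0}" (is "closedin _ ?Z")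
  unfolding closedin_def topspace_proj_zariski
proof
  show "openin (proj_zariski N) (proj_points N - ?Z)"
  proof (subst openin_subopen, intro ballI)
    fix p assume p: "p \<in> proj_points N - ?Z"
    then obtain v F where v: "v \<in> p" "F \<in> E" "F v \<noteq> 0" by auto
    obtain d where d: "hom_poly N d F" using assms v by blast
    note pv = proj_pointsE[of p N v]
    let ?T = "{p \<in> proj_points N. \<forall>v\<in>p. F v \<noteq> 0}"
    have "F v' \<noteq> 0" if "v' \<in> p" for v'
      using hom_poly_line[OF d, of v v'] pv p v that by auto
    \<comment> \<open>Points are nonempty sets of vectors; otherwise "all values zero" and "all
      values nonzero" could hold together.\<close>
    moreover have "q \<noteq> {}" if "q \<in> proj_points N" for q
      using that line_self unfolding proj_points_line by blast
    ultimately have "p \<in> ?T" "?T \<subseteq> proj_points N - ?Z" using p v(2) by auto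
    then show "\<exists>T. openin (proj_zariski N) T \<and> p \<in> T \<and> T \<subseteq> proj_points N - ?Z"
      using openin_proj_zariski[OF d] by blast
  qed
qed auto

section \<open>Binomial equations of the image\<close>

context smooth_polytope
begin

lemma hom_poly_coord_P: "m \<in> P \<Longrightarrow> hom_poly N 1 (\<lambda>v. coord v m)"
  unfolding coord_def by (rule hom_poly_coord) (rule enum_inv(1))

text \<open>For m in \<open>P\<close> this is the lattice distance from the i-th facet through
  \<open>vertex w\<close>, equivalently the i-th coordinate of \<open>m - vertex w\<close> in the
  edge basis; by \<open>vertex_min\<close> nothing is cut off by \<open>nat\<close>.\<close>

definition lattice_dist :: "'w \<Rightarrow> int vec \<Rightarrow> nat \<Rightarrow> nat" where
  "lattice_dist w m i = nat ((m - vertex w) \<bullet> ray w i)"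

definition midpoint_relation :: "int vec \<Rightarrow> int vec \<Rightarrow> complex vec \<Rightarrow> complex" where
  "midpoint_relation m x v = coord v (m + x) * coord v (m - x) - coord v m ^ 2"

text \<open>Homogenised form of the expansion of \<open>m - vertex w\<close> in the edge basis; the
  leading factor of the second term equalises the degrees.\<close>

definition edge_relation :: "'w \<Rightarrow> int vec \<Rightarrow> complex vec \<Rightarrow> complex" where
  "edge_relation w m v = coord v m * coord v (vertex w) ^ (\<Sum>i<k. lattice_dist w m i)
     - coord v (vertex w) * (\<Prod>i<k. coord v (vertex w + edge w i) ^ lattice_dist w m i)"

text \<open>
  Few binomials of the toric ideal suffice: \<^const>\<open>edge_relation\<close> expresses all coordinates
  through those at a nonvanishing vertex and its neighbours, and
  \<^const>\<open>midpoint_relation\<close> yields a nonvanishing vertex.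
\<close>

definition equations :: "(complex vec \<Rightarrow> complex) set" where
  "equations =
     {midpoint_relation m x | m x. m \<in> P \<and> x \<in> carrier_vec k \<and> m + x \<in> P \<and> m - x \<in> P} \<union>
     {edge_relation w m | w m. w \<in> W \<and> m \<in> P}"

definition image_variety :: "complex vec set set" where
  "image_variety = {p \<in> proj_points N. \<forall>v\<in>p. \<forall>F\<in>equations. F v = 0}"

lemma equations_cases:
  assumes "F \<in> equations"
  obtains (midpoint) m x where "F = midpoint_relation m x" "m \<in> P" "x \<in> carrier_vec k"
      "m + x \<in> P" "m - x \<in> P"
    | (edge) w m where "F = edge_relation w m" "w \<in> W" "m \<in> P"
  using assms unfolding equations_def by blast

lemma hom_poly_equations:
  assumes "F \<in> equations"
  shows "\<exists>d. hom_poly N d F"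
  using assms
proof (cases rule: equations_cases)
  case (midpoint m x)
  have "hom_poly N (1 + 1) (\<lambda>v. coord v (m + x) * coord v (m - x))"
    using midpoint by (intro hom_poly_mult hom_poly_coord_P)
  moreover have "hom_poly N (2 * 1) (\<lambda>v. coord v m ^ 2)"
    using midpoint by (intro hom_poly_power hom_poly_coord_P)
  ultimately have "hom_poly N 2 (\<lambda>v. midpoint_relation m x v)"
    unfolding midpoint_relation_def by (intro hom_poly_diff) (simp_all add: numeral_2_eq_2)
  then show ?thesis using midpoint(1) by auto
next
  case (edge w m)
  let ?n = "\<Sum>i<k. lattice_dist w m i"
  have "hom_poly N (1 + ?n * 1) (\<lambda>v. coord v m * coord v (vertex w) ^ ?n)"
    using edge by (intro hom_poly_mult hom_poly_power hom_poly_coord_P vertex_P)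
  moreover have "hom_poly N (1 + (\<Sum>i<k. lattice_dist w m i * 1))
      (\<lambda>v. coord v (vertex w) * (\<Prod>i<k. coord v (vertex w + edge w i) ^ lattice_dist w m i))"
    using edge by (intro hom_poly_mult hom_poly_prod hom_poly_power hom_poly_coord_P vertex_P edge_P)
      auto
  ultimately have "hom_poly N (1 + ?n) (\<lambda>v. edge_relation w m v)"
    unfolding edge_relation_def by (intro hom_poly_diff) simp_all
  then show ?thesis using edge(1) by auto
qed

lemma closedin_image_variety: "closedin (proj_zariski N) image_variety"
  unfolding image_variety_def by (rule closedin_hom_zeros) (rule hom_poly_equations)

lemma lattice_dist_sum:
  assumes "w \<in> W" "m \<in> P" "j < k"
  shows "(\<Sum>i<k. int (lattice_dist w m i) * edge w i $ j) = m $ j - vertex w $ j"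
proof -
  have "(m - vertex w) $ j = (\<Sum>i<k. ((m - vertex w) \<bullet> ray w i) * edge w i $ j)"
    using assms by (intro lattice_expand) auto
  also have "\<dots> = (\<Sum>i<k. int (lattice_dist w m i) * edge w i $ j)"
    using assms by (intro sum.cong refl) (simp add: lattice_dist_def vertex_min)
  finally show ?thesis using assms by simp
qed

text \<open>Each binomial records an equality between two sums of exponents, and \<gamma> is
  multiplicative. All exponents are taken relative to the vertex of the chart, even if the relation
  belongs to another vertex \<open>w'\<close>.\<close>

lemma equations_hom_coords:
  assumes w: "w \<in> W" "\<sigma> \<subseteq> full w" and \<gamma>: "\<gamma> \<in> toric_chart k \<sigma>" and F: "F \<in> equations"
  shows "F (hom_coords w \<gamma>) = 0"
proof -
  have dm: "m - vertex w \<in> dual_monoid k \<sigma>" if "m \<in> P" for m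
    using diff_vertex_dual_monoid[OF w that] .
  have \<sigma>: "\<sigma> \<subseteq> carrier_vec k" using w(2) cone_carrier by blast
  show ?thesis
    using F
  proof (cases rule: equations_cases)
    case (midpoint m x)
    have "(m + x - vertex w) + (m - x - vertex w) = (m - vertex w) + (m - vertex w)"
      using midpoint w by (intro eq_vecI) auto
    then have "\<gamma> (m + x - vertex w) * \<gamma> (m - x - vertex w) = \<gamma> (m - vertex w) * \<gamma> (m - vertex w)"
      using chart_add[OF \<gamma>] dm midpoint by metis
    then show ?thesis
      using midpoint by (simp add: midpoint_relation_def coord_hom_coords power2_eq_square)
  next
    case edge: (edge w' m)
    let ?n = "lattice_dist w' m"
    let ?s = "vec k (\<lambda>j. \<Sum>i<k. int (?n i) * (vertex w' + edge w' i - vertex w) $ j)"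
    have e: "vertex w' + edge w' i - vertex w \<in> dual_monoid k \<sigma>" if "i \<in> {..<k}" for i
      using dm edge_P[OF edge(2)] that by simp
    note s = chart_sum[OF \<sigma> \<gamma> finite_lessThan e, where n = ?n]
    note v = dm[OF vertex_P[OF edge(2)]]
    note c = chart_smult[OF \<sigma> \<gamma> v, of "\<Sum>i<k. ?n i"]
    have eq: "(m - vertex w) + int (\<Sum>i<k. ?n i) \<cdot>\<^sub>v (vertex w' - vertex w)
        = (vertex w' - vertex w) + ?s"
    proof (rule eq_vecI)
      fix j assume "j < dim_vec ((vertex w' - vertex w) + ?s)"
      then have j: "j < k" by simp
      have "(\<Sum>i<k. int (?n i) * (vertex w' + edge w' i - vertex w) $ j)
          = (\<Sum>i<k. int (?n i) * edge w' i $ j) + (\<Sum>i<k. int (?n i)) * (vertex w' $ j - vertex w $ j)"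
        using edge w j
        by (simp add: sum.distrib sum_subtractf sum_distrib_right right_diff_distrib distrib_left)
      also have "\<dots> = m $ j - vertex w' $ j + (\<Sum>i<k. int (?n i)) * (vertex w' $ j - vertex w $ j)"
        using lattice_dist_sum[OF edge(2,3) j] by simp
      finally show "((m - vertex w) + int (\<Sum>i<k. ?n i) \<cdot>\<^sub>v (vertex w' - vertex w)) $ j
          = ((vertex w' - vertex w) + ?s) $ j"
        using edge w j by simp
    qed (use edge w in simp)
    have "\<gamma> (m - vertex w) * \<gamma> (vertex w' - vertex w) ^ (\<Sum>i<k. ?n i)
        = \<gamma> ((m - vertex w) + int (\<Sum>i<k. ?n i) \<cdot>\<^sub>v (vertex w' - vertex w))"
      by (simp only: chart_add[OF \<gamma> dm[OF edge(3)] conjunct1[OF c]] conjunct2[OF c])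
    also have "\<dots> = \<gamma> (vertex w' - vertex w) * (\<Prod>i<k. \<gamma> (vertex w' + edge w' i - vertex w) ^ ?n i)"
      by (simp only: eq chart_add[OF \<gamma> v conjunct1[OF s]] conjunct2[OF s])
    finally show ?thesis
      using edge by (simp add: edge_relation_def coord_hom_coords vertex_P edge_P)
  qed
qed

lemma point_image_variety:
  assumes "\<sigma> \<in> normal_fan" "\<gamma> \<in> toric_chart k \<sigma>"
  shows "point \<sigma> \<gamma> \<in> image_variety"
proof -
  obtain w S where w: "w \<in> W" "\<sigma> \<subseteq> full w" using assms(1) by (rule normal_fanE)
  have "F v = 0" if "v \<in> line (hom_coords w \<gamma>)" "F \<in> equations" for v F
    using that hom_poly_equations[OF that(2)] equations_hom_coords[OF w assms(2) that(2)]
      hom_poly_line[OF _ hom_coords_carrier that(1)] by blast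
  then show ?thesis
    unfolding image_variety_def point_eq[OF w assms(2)]
    using line_hom_coords_proj[OF w(1) assms(2)] by blast
qed

text \<open>
  Among the lattice points of \<open>P\<close> with nonzero coordinate, one of maximal norm is a vertex:
  the equations propagate nonvanishing from \<open>m\<close> to \<open>m \<plusminus> x\<close>.
\<close>

lemma image_variety_vertex:
  assumes "p \<in> image_variety" "v \<in> p"
  shows "\<exists>w\<in>W. coord v (vertex w) \<noteq> 0"
proof -
  note v = proj_pointsE[of p N v]
  let ?M = "{m \<in> P. coord v m \<noteq> 0}"
  have p: "p \<in> proj_points N" using assms by (simp add: image_variety_def)
  have "?M \<noteq> {}"
  proof
    assume "?M = {}"
    then have "v = 0\<^sub>v (Suc N)"
      using v[OF p assms(2)] enum_inv(1)
      by (intro coord_eqI) (auto simp: coord_def less_Suc_eq_le)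
    then show False using v[OF p assms(2)] by simp
  qed
  moreover have fin: "finite ?M" using finite_P by simp
  ultimately have "Max ((\<lambda>m. m \<bullet> m) ` ?M) \<in> (\<lambda>m. m \<bullet> m) ` ?M" by (intro Max_in) auto
  then obtain m where m: "m \<in> ?M" "m \<bullet> m = Max ((\<lambda>m. m \<bullet> m) ` ?M)" by auto
  then have max: "m' \<bullet> m' \<le> m \<bullet> m" if "m' \<in> ?M" for m' using that fin by simp
  have "m \<in> vertex ` W"
  proof (rule ccontr)
    assume "m \<notin> vertex ` W"
    then obtain x where x: "x \<in> carrier_vec k" "x \<noteq> 0\<^sub>v k" "m + x \<in> P" "m - x \<in> P"
      using non_vertex m(1) by blast
    have "midpoint_relation m x \<in> equations"
      using m x unfolding equations_def by blast
    then have "midpoint_relation m x v = 0"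
      using assms unfolding image_variety_def by blast
    then have "coord v (m + x) * coord v (m - x) - coord v m ^ 2 = 0"
      unfolding midpoint_relation_def .
    then have "m + x \<in> ?M" "m - x \<in> ?M" using x m by auto
    from this[THEN max] have le: "(m + x) \<bullet> (m + x) + (m - x) \<bullet> (m - x) \<le> 2 * (m \<bullet> m)" by simp
    have mk: "m \<in> carrier_vec k" using m by simp
    \<comment> \<open>The parallelogram law: if x is nonzero, m + x and m - x cannot both be at most
      as long as m.\<close>
    have "(m + x) \<bullet> (m + x) + (m - x) \<bullet> (m - x) = (\<Sum>j<k. 2 * (m $ j * m $ j) + 2 * (x $ j * x $ j))"
      using mk x by (simp add: scalar_prod_def lessThan_atLeast0 sum.distrib[symmetric] algebra_simps)
    also have "\<dots> = 2 * (m \<bullet> m) + 2 * (x \<bullet> x)"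
      using mk x by (simp add: scalar_prod_def lessThan_atLeast0 sum.distrib sum_distrib_left)
    finally have "x \<bullet> x \<le> 0" using le by simp
    moreover have "0 < x \<bullet> x"
    proof -
      obtain j where "j < k" "x $ j \<noteq> 0"
        using x(1,2) by (metis carrier_vecD eq_vecI index_zero_vec)
      then show ?thesis
        by (auto simp: scalar_prod_carrier[OF x(1)] zero_less_mult_iff linorder_neq_iff
            intro!: sum_pos2[of _ j])
    qed
    ultimately show False by simp
  qed
  then show ?thesis using m by auto
qed

definition affine_coords :: "'w \<Rightarrow> complex vec \<Rightarrow> int vec \<Rightarrow> complex" where
  "affine_coords w v =
     restrict (torus_monomial w (\<lambda>i. coord v (vertex w + edge w i) / coord v (vertex w)))
       (dual_monoid k (full w))"

text \<open>On the chart of a full cone all coordinates may vanish, so every tuple of complex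
  numbers gives a point, including the default values of a division by zero.\<close>

lemma affine_coords_chart: "w \<in> W \<Longrightarrow> affine_coords w v \<in> toric_chart k (full w)"
  unfolding affine_coords_def by (rule torus_monomial_chart) auto

lemma affine_coords_eq:
  assumes "w \<in> W" "r \<in> dual_monoid k (full w)"
  shows "affine_coords w v r = (\<Prod>i<k. coord v (vertex w + edge w i) ^ nat (r \<bullet> ray w i))
    / coord v (vertex w) ^ (\<Sum>i<k. nat (r \<bullet> ray w i))"
proof -
  have "affine_coords w v r
      = (\<Prod>i<k. (coord v (vertex w + edge w i) / coord v (vertex w)) powi (r \<bullet> ray w i))"
    using assms by (simp add: affine_coords_def torus_monomial_def)
  also have "\<dots> = (\<Prod>i<k. coord v (vertex w + edge w i) ^ nat (r \<bullet> ray w i)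
      / coord v (vertex w) ^ nat (r \<bullet> ray w i))"
    using assms by (intro prod.cong refl)
      (simp add: dual_monoid_cone power_int_def power_divide)
  finally show ?thesis by (simp add: prod_dividef power_sum)
qed

text \<open>\<open>edge_relation\<close> can be solved for the coordinate at m because the one at
  \<open>vertex w\<close> is nonzero.\<close>

lemma hom_coords_affine_coords:
  assumes w: "w \<in> W" and v: "v \<in> carrier_vec (Suc N)" "coord v (vertex w) \<noteq> 0"
    and eqs: "\<And>F. F \<in> equations \<Longrightarrow> F v = 0"
  shows "hom_coords w (affine_coords w v) = (1 / coord v (vertex w)) \<cdot>\<^sub>v v"
proof (rule coord_eqI)
  fix m assume m: "m \<in> P"
  have "edge_relation w m \<in> equations"
    using w m unfolding equations_def by blast
  from eqs[OF this, unfolded edge_relation_def] have "coord v m / coord v (vertex w)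
      = (\<Prod>i<k. coord v (vertex w + edge w i) ^ lattice_dist w m i)
        / coord v (vertex w) ^ (\<Sum>i<k. lattice_dist w m i)"
    using v(2) by (simp add: field_simps)
  also have "\<dots> = affine_coords w v (m - vertex w)"
    using affine_coords_eq[OF w diff_vertex_dual_monoid[OF w subset_refl m]]
    by (simp add: lattice_dist_def)
  finally show "coord (hom_coords w (affine_coords w v)) m = coord ((1 / coord v (vertex w)) \<cdot>\<^sub>v v) m"
    using m v by (simp add: coord_hom_coords coord_smult)
qed (use v in simp_all)

lemma point_affine_coords:
  assumes w: "w \<in> W" and p: "p \<in> image_variety" "v \<in> p" "coord v (vertex w) \<noteq> 0"
  shows "point (full w) (affine_coords w v) = p"
proof -
  have pN: "p \<in> proj_points N" using p by (simp add: image_variety_def)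
  note pv = proj_pointsE[OF pN p(2)]
  have "hom_coords w (affine_coords w v) = (1 / coord v (vertex w)) \<cdot>\<^sub>v v"
    using p by (intro hom_coords_affine_coords w pv(2)) (auto simp: image_variety_def)
  then have "hom_coords w (affine_coords w v) \<in> line v" using p(3) unfolding line_def by auto
  then show ?thesis
    using mem_line pv(1) point_eq[OF w subset_refl affine_coords_chart[OF w]] by metis
qed

end

section \<open>The isomorphism\<close>

lemma coordinate_ringI:
  assumes "finite I" "\<And>x. x \<in> I \<Longrightarrow> q x \<in> dual_monoid k \<sigma>"
  shows "(\<lambda>\<gamma>. \<Sum>x\<in>I. a x * \<gamma> (q x)) \<in> coordinate_ring k \<sigma>"
  unfolding coordinate_ring_def
proof (intro CollectI exI conjI ext)
  show "finite (q ` I)" "q ` I \<subseteq> dual_monoid k \<sigma>" using assms by auto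
  fix \<gamma> :: "int vec \<Rightarrow> complex"
  have "(\<Sum>x\<in>I. a x * \<gamma> (q x)) = (\<Sum>m\<in>q ` I. \<Sum>x\<in>{x \<in> I. q x = m}. a x * \<gamma> (q x))"
    by (rule sum.image_gen[OF assms(1)])
  also have "\<dots> = (\<Sum>m\<in>q ` I. (\<Sum>x\<in>{x \<in> I. q x = m}. a x) * \<gamma> m)"
    by (simp add: sum_distrib_right)
  finally show "(\<Sum>x\<in>I. a x * \<gamma> (q x)) = (\<Sum>m\<in>q ` I. (\<Sum>x\<in>{x \<in> I. q x = m}. a x) * \<gamma> m)" .
qed

lemma openin_chart_zariski:
  "F \<in> coordinate_ring k \<sigma> \<Longrightarrow> openin (chart_zariski k \<sigma>) {\<gamma> \<in> toric_chart k \<sigma>. F \<gamma> \<noteq> 0}"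
  unfolding chart_zariski_def by (rule topology_generated_by_Basis) blast

lemma topspace_chart_zariski:
  assumes "0\<^sub>v k \<in> dual_monoid k \<sigma>"
  shows "topspace (chart_zariski k \<sigma>) = toric_chart k \<sigma>"
  unfolding chart_zariski_def topology_generated_by_topspace
proof (intro subset_antisym subsetI)
  have "(\<lambda>\<gamma>. \<Sum>x\<in>{()}. 1 * \<gamma> (0\<^sub>v k)) \<in> coordinate_ring k \<sigma>"
    using assms by (intro coordinate_ringI) auto
  then have "(\<lambda>\<gamma>. \<gamma> (0\<^sub>v k)) \<in> coordinate_ring k \<sigma>" by simp
  then have mem: "{\<gamma> \<in> toric_chart k \<sigma>. (\<lambda>\<gamma>. \<gamma> (0\<^sub>v k)) \<gamma> \<noteq> 0}
      \<in> {{\<gamma> \<in> toric_chart k \<sigma>. F \<gamma> \<noteq> 0} | F. F \<in> coordinate_ring k \<sigma>}"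
    by (intro CollectI exI[of _ "\<lambda>\<gamma>. \<gamma> (0\<^sub>v k)"] conjI refl)
  fix \<gamma> assume "\<gamma> \<in> toric_chart k \<sigma>"
  then show "\<gamma> \<in> \<Union> {{\<gamma> \<in> toric_chart k \<sigma>. F \<gamma> \<noteq> 0} | F. F \<in> coordinate_ring k \<sigma>}"
    by (intro UnionI[OF mem]) (simp add: toric_chart_def)
qed auto

lemma openin_toric_variety: "openin (zariski (toric_variety k \<Sigma>)) V \<longleftrightarrow> toric_open k \<Sigma> V"
  by (simp add: toric_variety_def topology_inverse'[OF istopology_toric_open])

context smooth_polytope
begin

abbreviation X :: "toric_point fun_space" where
  "X \<equiv> toric_variety k normal_fan"

abbreviation Z :: "complex vec set set" where
  "Z \<equiv> image_variety"

abbreviation TZ :: "complex vec set topology" where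
  "TZ \<equiv> subtopology (proj_zariski N) Z"

lemma Z_proj: "Z \<subseteq> proj_points N"
  by (auto simp: image_variety_def)

lemma topspace_TZ: "topspace TZ = Z"
  using Z_proj by (auto simp: topspace_proj_zariski)

section \<open>Transfer between homogeneous polynomials and coordinate rings\<close>

lemma hom_poly_pullback:
  assumes w: "w \<in> W" "\<sigma> \<subseteq> full w" and F: "hom_poly N d F"
  shows "\<exists>G\<in>coordinate_ring k \<sigma>. \<forall>\<gamma>\<in>toric_chart k \<sigma>. F (hom_coords w \<gamma>) = G \<gamma>"
proof -
  obtain E a where E: "finite E" "F = (\<lambda>v. \<Sum>\<alpha>\<in>E. a \<alpha> * (\<Prod>i\<le>N. (v $ i) ^ \<alpha> i))"
    using F by (auto simp: hom_poly_def)
  let ?q = "\<lambda>\<alpha>. vec k (\<lambda>j. \<Sum>i\<in>{..N}. int (\<alpha> i) * (enum i - vertex w) $ j)"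
  have \<sigma>: "\<sigma> \<subseteq> carrier_vec k" using w(2) cone_carrier by blast
  have e: "enum i - vertex w \<in> dual_monoid k \<sigma>" if "i \<in> {..N}" for i
    using diff_vertex_dual_monoid[OF w enum_P] that by simp
  \<comment> \<open>The constant homomorphism 1 is a chart point that is always available; it gives
    access to the membership half of \<open>chart_sum\<close>, which does not depend on the
    point.\<close>
  have one: "restrict (\<lambda>_. 1) (dual_monoid k \<sigma>) \<in> toric_chart k \<sigma>"
    using zero_dual_monoid[OF \<sigma>] add_dual_monoid[OF \<sigma>] by (simp add: toric_chart_def)
  have q: "?q \<alpha> \<in> dual_monoid k \<sigma>" for \<alpha>
    using chart_sum[OF \<sigma> one, of "{..N}" "\<lambda>i. enum i - vertex w" \<alpha>] e by blast
  show ?thesis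
  proof (intro bexI ballI)
    show "(\<lambda>\<gamma>. \<Sum>\<alpha>\<in>E. a \<alpha> * \<gamma> (?q \<alpha>)) \<in> coordinate_ring k \<sigma>"
      using E(1) q by (rule coordinate_ringI)
    fix \<gamma> assume \<gamma>: "\<gamma> \<in> toric_chart k \<sigma>"
    have "(\<Prod>i\<le>N. (hom_coords w \<gamma> $ i) ^ \<alpha> i) = \<gamma> (?q \<alpha>)" for \<alpha>
    proof -
      have "(\<Prod>i\<le>N. (hom_coords w \<gamma> $ i) ^ \<alpha> i) = (\<Prod>i\<in>{..N}. \<gamma> (enum i - vertex w) ^ \<alpha> i)"
        by (intro prod.cong) (auto simp: hom_coords_def)
      then show ?thesis
        using chart_sum[OF \<sigma> \<gamma>, of "{..N}" "\<lambda>i. enum i - vertex w" \<alpha>] e by simp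
    qed
    then show "F (hom_coords w \<gamma>) = (\<Sum>\<alpha>\<in>E. a \<alpha> * \<gamma> (?q \<alpha>))" by (simp add: E(2))
  qed
qed

text \<open>Each character becomes a monomial divided by a power of the vertex coordinate. All large
  \<open>D\<close> are allowed so that the two parts of a fraction can be brought to one
  degree.\<close>

lemma coordinate_ring_homogenize:
  assumes w: "w \<in> W" and F: "F \<in> coordinate_ring k (full w)"
  shows "\<exists>D0. \<forall>D\<ge>D0. \<exists>H. hom_poly N D H \<and>
    (\<forall>v. coord v (vertex w) \<noteq> 0 \<longrightarrow> F (affine_coords w v) = H v / coord v (vertex w) ^ D)"
proof -
  obtain A a where A: "finite A" "A \<subseteq> dual_monoid k (full w)" "F = (\<lambda>\<gamma>. \<Sum>r\<in>A. a r * \<gamma> r)"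
    using F by (auto simp: coordinate_ring_def)
  let ?n = "\<lambda>r i. nat (r \<bullet> ray w i)"
  let ?d = "\<lambda>r. \<Sum>i<k. ?n r i"
  show ?thesis
  proof (rule exI[of _ "\<Sum>r\<in>A. ?d r"], intro allI impI)
    fix D assume D: "D \<ge> (\<Sum>r\<in>A. ?d r)"
    have le: "?d r \<le> D" if "r \<in> A" for r
      using member_le_sum[of r A ?d] that A(1) D by simp
    let ?H = "\<lambda>v. \<Sum>r\<in>A. a r * (coord v (vertex w) ^ (D - ?d r) *
      (\<Prod>i<k. coord v (vertex w + edge w i) ^ ?n r i))"
    show "\<exists>H. hom_poly N D H \<and>
      (\<forall>v. coord v (vertex w) \<noteq> 0 \<longrightarrow> F (affine_coords w v) = H v / coord v (vertex w) ^ D)"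
    proof (intro exI[of _ ?H] conjI allI impI)
      have "hom_poly N (0 + ((D - ?d r) * 1 + (\<Sum>i<k. ?n r i * 1)))
          (\<lambda>v. a r * (coord v (vertex w) ^ (D - ?d r) *
            (\<Prod>i<k. coord v (vertex w + edge w i) ^ ?n r i)))" for r
        using w by (intro hom_poly_mult hom_poly_const hom_poly_prod hom_poly_power hom_poly_coord_P
            vertex_P edge_P) auto
      then have "hom_poly N D (\<lambda>v. a r * (coord v (vertex w) ^ (D - ?d r) *
            (\<Prod>i<k. coord v (vertex w + edge w i) ^ ?n r i)))" if "r \<in> A" for r
        using le[OF that] by (metis (no_types, lifting) add_0 le_add_diff_inverse2 mult_1_right sum.cong)
      then show "hom_poly N D ?H"
        by (intro hom_poly_sum A(1))
      fix v assume v: "coord v (vertex w) \<noteq> 0"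
      have "affine_coords w v r = coord v (vertex w) ^ (D - ?d r) *
          (\<Prod>i<k. coord v (vertex w + edge w i) ^ ?n r i) / coord v (vertex w) ^ D" if "r \<in> A" for r
      proof -
        have "coord v (vertex w) ^ D = coord v (vertex w) ^ (D - ?d r) * coord v (vertex w) ^ ?d r"
          using le[OF that] by (simp add: power_add[symmetric])
        moreover have "r \<in> dual_monoid k (full w)" using that A(2) by auto
        ultimately show ?thesis using v by (simp add: affine_coords_eq[OF w])
      qed
      then show "F (affine_coords w v) = ?H v / coord v (vertex w) ^ D"
        by (simp add: A(3) sum_divide_distrib)
    qed
  qed
qed

lemma topspace_chart: "\<sigma> \<in> normal_fan \<Longrightarrow> topspace (chart_zariski k \<sigma>) = toric_chart k \<sigma>"
  by (rule topspace_chart_zariski[OF zero_dual_monoid]) (auto simp: normal_fan_def intro: subsetD[OF cone_carrier])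

lemma continuous_point:
  assumes "\<sigma> \<in> normal_fan"
  shows "continuous_map (chart_zariski k \<sigma>) (proj_zariski N) (point \<sigma>)"
proof -
  obtain w S where w: "w \<in> W" "\<sigma> \<subseteq> full w" using assms by (rule normal_fanE)
  have pt: "point \<sigma> \<gamma> \<in> proj_points N" if "\<gamma> \<in> toric_chart k \<sigma>" for \<gamma>
    using point_image_variety[OF assms that] Z_proj by blast
  show ?thesis
    unfolding proj_zariski_def
  proof (rule continuous_on_generated_topo)
    fix U assume "U \<in> {{p \<in> proj_points N. \<forall>v\<in>p. F v \<noteq> 0} | d F. hom_poly N d F}"
    then obtain d F where U: "U = {p \<in> proj_points N. \<forall>v\<in>p. F v \<noteq> 0}" and F: "hom_poly N d F"
      by blast
    obtain G where G: "G \<in> coordinate_ring k \<sigma>"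
      "\<forall>\<gamma>\<in>toric_chart k \<sigma>. F (hom_coords w \<gamma>) = G \<gamma>"
      using hom_poly_pullback[OF w F] by blast
    have "point \<sigma> \<gamma> \<in> U \<longleftrightarrow> G \<gamma> \<noteq> 0" if \<gamma>: "\<gamma> \<in> toric_chart k \<sigma>" for \<gamma>
      using pt[OF \<gamma>] G(2) \<gamma> hom_poly_line[OF F hom_coords_carrier, of _ w \<gamma>] line_self
      unfolding U point_eq[OF w \<gamma>] by auto
    then have "point \<sigma> -` U \<inter> topspace (chart_zariski k \<sigma>) = {\<gamma> \<in> toric_chart k \<sigma>. G \<gamma> \<noteq> 0}"
      unfolding topspace_chart[OF assms] by auto
    then show "openin (chart_zariski k \<sigma>) (point \<sigma> -` U \<inter> topspace (chart_zariski k \<sigma>))"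
      using openin_chart_zariski[OF G(1)] by simp
  next
    have "point \<sigma> ` topspace (chart_zariski k \<sigma>) \<subseteq> topspace (proj_zariski N)"
      using pt by (auto simp: topspace_chart[OF assms] topspace_proj_zariski)
    then show "point \<sigma> ` topspace (chart_zariski k \<sigma>)
        \<subseteq> \<Union> {{p \<in> proj_points N. \<forall>v\<in>p. F v \<noteq> 0} | d F. hom_poly N d F}"
      by (simp only: proj_zariski_def topology_generated_by_topspace)
  qed
qed

section \<open>Inverse charts on the image\<close>

definition chart_locus :: "'w \<Rightarrow> complex vec set set" where
  "chart_locus w = {p \<in> Z. \<forall>v\<in>p. coord v (vertex w) \<noteq> 0}"

definition inverse_chart :: "'w \<Rightarrow> complex vec set \<Rightarrow> int vec \<Rightarrow> complex" where
  "inverse_chart w p = affine_coords w (SOME v. v \<in> p)"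

lemma openin_chart_locus:
  assumes "w \<in> W"
  shows "openin TZ (chart_locus w)"
proof -
  have "chart_locus w = {p \<in> proj_points N. \<forall>v\<in>p. coord v (vertex w) \<noteq> 0} \<inter> Z"
    using Z_proj by (auto simp: chart_locus_def)
  then show ?thesis
    using openin_proj_zariski[OF hom_poly_coord_P[OF vertex_P[OF assms]]]
    by (auto simp: openin_subtopology)
qed

lemma chart_locus_cover:
  assumes "p \<in> Z"
  shows "\<exists>w\<in>W. p \<in> chart_locus w"
proof -
  have pN: "p \<in> proj_points N" using assms Z_proj by blast
  then obtain v where v: "v \<in> p" using line_self unfolding proj_points_line by blast
  obtain w where w: "w \<in> W" "coord v (vertex w) \<noteq> 0"
    using image_variety_vertex[OF assms v] by blast
  have "coord v' (vertex w) \<noteq> 0" if "v' \<in> p" for v'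
    using hom_poly_line[OF hom_poly_coord_P[OF vertex_P[OF w(1)]], of v v'] w(2) that
      proj_pointsE[OF pN v] by auto
  then show ?thesis using assms w by (auto simp: chart_locus_def)
qed

text \<open>A rescaled representative gives the same quotients of coordinates, so the choice in
  \<open>inverse_chart\<close> does not matter.\<close>

lemma inverse_chart_eq:
  assumes w: "w \<in> W" and p: "p \<in> Z" "v \<in> p"
  shows "inverse_chart w p = affine_coords w v"
proof -
  have pN: "p \<in> proj_points N" using p Z_proj by blast
  note pv = proj_pointsE[OF pN p(2)]
  have "(SOME v. v \<in> p) \<in> p" using p(2) by (rule someI)
  then obtain t where t: "t \<noteq> 0" "(SOME v. v \<in> p) = t \<cdot>\<^sub>v v" using pv(1) by (auto simp: line_def)
  have "coord (t \<cdot>\<^sub>v v) (vertex w + edge w i) / coord (t \<cdot>\<^sub>v v) (vertex w)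
      = coord v (vertex w + edge w i) / coord v (vertex w)" if "i < k" for i
    using t(1) w that pv(2) by (simp add: coord_smult vertex_P edge_P)
  then have "torus_monomial w (\<lambda>i. coord (t \<cdot>\<^sub>v v) (vertex w + edge w i) / coord (t \<cdot>\<^sub>v v) (vertex w))
      = torus_monomial w (\<lambda>i. coord v (vertex w + edge w i) / coord v (vertex w))"
    unfolding torus_monomial_def by (intro ext prod.cong) auto
  then show ?thesis unfolding inverse_chart_def t(2) affine_coords_def by (simp only:)
qed

lemma point_inverse_chart:
  assumes w: "w \<in> W" and p: "p \<in> chart_locus w"
  shows "point (full w) (inverse_chart w p) = p"
proof -
  have pZ: "p \<in> Z" and nz: "\<And>v. v \<in> p \<Longrightarrow> coord v (vertex w) \<noteq> 0"
    using p by (auto simp: chart_locus_def)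
  then obtain v where v: "v \<in> p" using Z_proj line_self unfolding proj_points_line by blast
  show ?thesis
    unfolding inverse_chart_eq[OF w pZ v] by (rule point_affine_coords[OF w pZ v nz[OF v]])
qed

lemma inverse_chart_chart: "w \<in> W \<Longrightarrow> inverse_chart w p \<in> toric_chart k (full w)"
  unfolding inverse_chart_def by (rule affine_coords_chart)

text \<open>On \<open>chart_locus w\<close> the vertex coordinate is nonzero, so a function of the
  coordinate ring vanishes exactly where the numerator of its homogenisation does.\<close>

lemma continuous_inverse_chart:
  assumes w: "w \<in> W"
  shows "continuous_map (subtopology TZ (chart_locus w)) (chart_zariski k (full w)) (inverse_chart w)"
proof -
  have top: "topspace (subtopology TZ (chart_locus w)) = chart_locus w"
    using topspace_TZ by (auto simp: chart_locus_def)
  show ?thesis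
    unfolding chart_zariski_def
  proof (rule continuous_on_generated_topo)
    fix U assume "U \<in> {{\<gamma> \<in> toric_chart k (full w). F \<gamma> \<noteq> 0} | F. F \<in> coordinate_ring k (full w)}"
    then obtain F where U: "U = {\<gamma> \<in> toric_chart k (full w). F \<gamma> \<noteq> 0}"
      and F: "F \<in> coordinate_ring k (full w)" by blast
    obtain D H where H: "hom_poly N D H"
      "\<And>v. coord v (vertex w) \<noteq> 0 \<Longrightarrow> F (affine_coords w v) = H v / coord v (vertex w) ^ D"
      using coordinate_ring_homogenize[OF w F] by blast
    have "inverse_chart w p \<in> U \<longleftrightarrow> (\<forall>v\<in>p. H v \<noteq> 0)" if p: "p \<in> chart_locus w" for p
    proof -
      have pZ: "p \<in> Z" and nz: "\<And>v. v \<in> p \<Longrightarrow> coord v (vertex w) \<noteq> 0"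
        using p by (auto simp: chart_locus_def)
      obtain v where v: "v \<in> p" using pZ Z_proj line_self unfolding proj_points_line by blast
      have "F (inverse_chart w p) \<noteq> 0 \<longleftrightarrow> H v \<noteq> 0" if "v \<in> p" for v
        using H(2)[OF nz[OF that]] nz[OF that] inverse_chart_eq[OF w pZ that] by simp
      then show ?thesis using v inverse_chart_chart[OF w] unfolding U by auto
    qed
    then have "inverse_chart w -` U \<inter> topspace (subtopology TZ (chart_locus w))
        = {p \<in> proj_points N. \<forall>v\<in>p. H v \<noteq> 0} \<inter> (Z \<inter> chart_locus w)"
      unfolding top using Z_proj by (auto simp: chart_locus_def)
    then show "openin (subtopology TZ (chart_locus w))
        (inverse_chart w -` U \<inter> topspace (subtopology TZ (chart_locus w)))"
      using openin_proj_zariski[OF H(1)] by (auto simp: subtopology_subtopology openin_subtopology)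
  next
    have "inverse_chart w ` chart_locus w \<subseteq> topspace (chart_zariski k (full w))"
      using inverse_chart_chart[OF w] by (auto simp: topspace_chart[OF full_normal_fan[OF w]])
    then show "inverse_chart w ` topspace (subtopology TZ (chart_locus w))
        \<subseteq> \<Union> {{\<gamma> \<in> toric_chart k (full w). F \<gamma> \<noteq> 0} | F. F \<in> coordinate_ring k (full w)}"
      by (simp only: top chart_zariski_def topology_generated_by_topspace)
  qed
qed

lemma openin_inverse_chart:
  assumes w: "w \<in> W" and U: "openin (chart_zariski k (full w)) U"
  shows "openin TZ {p \<in> chart_locus w. inverse_chart w p \<in> U}"
proof -
  have "topspace (subtopology TZ (chart_locus w)) = chart_locus w"
    using topspace_TZ by (auto simp: chart_locus_def)
  then have "openin (subtopology TZ (chart_locus w)) {p \<in> chart_locus w. inverse_chart w p \<in> U}"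
    using openin_continuous_map_preimage[OF continuous_inverse_chart[OF w] U] by simp
  then show ?thesis using openin_trans_full openin_chart_locus[OF w] by blast
qed

text \<open>The toric point over p, described as the fibre of \<open>point\<close> over p; by
  \<open>gluing_class\<close> it is a gluing class when p is in the image.\<close>

definition chart_class :: "complex vec set \<Rightarrow> toric_point" where
  "chart_class p = {(\<sigma>, \<gamma>). \<sigma> \<in> normal_fan \<and> \<gamma> \<in> toric_chart k \<sigma> \<and> point \<sigma> \<gamma> = p}"

lemma gluing_class:
  "\<lbrakk>\<sigma> \<in> normal_fan; \<gamma> \<in> toric_chart k \<sigma>\<rbrakk> \<Longrightarrow> gluing k normal_fan `` {(\<sigma>, \<gamma>)} = chart_class (point \<sigma> \<gamma>)"
  unfolding gluing_eq chart_class_def by auto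

text \<open>Some inverse chart is defined at p, so the class contains a pair from which
  \<open>point\<close> gives p back.\<close>

lemma chart_class_inj: "inj_on chart_class Z"
proof (rule inj_onI)
  fix p q assume p: "p \<in> Z" "chart_class p = chart_class q"
  obtain w where w: "w \<in> W" "p \<in> chart_locus w" using chart_locus_cover[OF p(1)] by blast
  have "(full w, inverse_chart w p) \<in> chart_class p"
    using w by (simp add: chart_class_def full_normal_fan inverse_chart_chart point_inverse_chart)
  then have "point (full w) (inverse_chart w p) = q" unfolding p(2) by (simp add: chart_class_def)
  then show "p = q" using w by (simp add: point_inverse_chart)
qed

lemma toric_points_eq: "toric_points k normal_fan = chart_class ` Z"
proof (intro subset_antisym subsetI)
  fix C assume "C \<in> toric_points k normal_fan"
  then obtain \<sigma> \<gamma> where *: "\<sigma> \<in> normal_fan" "\<gamma> \<in> toric_chart k \<sigma>" "C = gluing k normal_fan `` {(\<sigma>, \<gamma>)}"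
    unfolding toric_points_def by (auto elim!: quotientE)
  then show "C \<in> chart_class ` Z"
    using point_image_variety[OF *(1,2)] gluing_class[OF *(1,2)] by blast
next
  fix C assume "C \<in> chart_class ` Z"
  then obtain p where p: "p \<in> Z" "C = chart_class p" by blast
  obtain w where w: "w \<in> W" "p \<in> chart_locus w" using chart_locus_cover[OF p(1)] by blast
  have "C = gluing k normal_fan `` {(full w, inverse_chart w p)}"
    using w by (simp add: p(2) gluing_class full_normal_fan inverse_chart_chart point_inverse_chart)
  moreover have "(full w, inverse_chart w p) \<in> (SIGMA \<sigma>:normal_fan. toric_chart k \<sigma>)"
    using w by (simp add: full_normal_fan inverse_chart_chart)
  ultimately show "C \<in> toric_points k normal_fan" unfolding toric_points_def by (auto intro: quotientI)
qed

lemma chart_preimage_eq: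
  "\<sigma> \<in> normal_fan \<Longrightarrow>
    chart_preimage k normal_fan \<sigma> V = {\<gamma> \<in> toric_chart k \<sigma>. chart_class (point \<sigma> \<gamma>) \<in> V}"
  unfolding chart_preimage_def by (auto simp: gluing_class)

lemma topspace_X: "topspace (zariski X) = toric_points k normal_fan"
proof -
  have "chart_preimage k normal_fan \<sigma> (toric_points k normal_fan) = topspace (chart_zariski k \<sigma>)"
    if "\<sigma> \<in> normal_fan" for \<sigma>
    using that point_image_variety[OF that]
    by (auto simp: chart_preimage_eq topspace_chart toric_points_eq)
  then have "toric_open k normal_fan (toric_points k normal_fan)"
    by (simp add: toric_open_def)
  moreover have "V \<subseteq> toric_points k normal_fan" if "toric_open k normal_fan V" for V
    using that by (simp add: toric_open_def)
  ultimately show ?thesis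
    unfolding topspace_def openin_toric_variety by blast
qed

definition toric_embedding :: "toric_point \<Rightarrow> complex vec set" where
  "toric_embedding = inv_into Z chart_class"

lemma toric_embedding_class: "p \<in> Z \<Longrightarrow> toric_embedding (chart_class p) = p"
  unfolding toric_embedding_def by (rule inv_into_f_f[OF chart_class_inj])

lemma chart_preimage_toric_embedding:
  assumes "\<sigma> \<in> normal_fan"
  shows "chart_preimage k normal_fan \<sigma> {C \<in> toric_points k normal_fan. toric_embedding C \<in> U}
    = {\<gamma> \<in> toric_chart k \<sigma>. point \<sigma> \<gamma> \<in> U}"
  using point_image_variety[OF assms] by (auto simp: chart_preimage_eq[OF assms] toric_points_eq toric_embedding_class)

lemma openin_point_preimage:
  assumes "\<sigma> \<in> normal_fan" "openin TZ U"
  shows "openin (chart_zariski k \<sigma>) {\<gamma> \<in> toric_chart k \<sigma>. point \<sigma> \<gamma> \<in> U}"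
proof -
  obtain U' where U': "openin (proj_zariski N) U'" "U = U' \<inter> Z"
    using assms(2) by (auto simp: openin_subtopology)
  have "{\<gamma> \<in> toric_chart k \<sigma>. point \<sigma> \<gamma> \<in> U}
      = {\<gamma> \<in> topspace (chart_zariski k \<sigma>). point \<sigma> \<gamma> \<in> U'}"
    using point_image_variety[OF assms(1)] by (auto simp: U'(2) topspace_chart[OF assms(1)])
  then show ?thesis
    using openin_continuous_map_preimage[OF continuous_point[OF assms(1)] U'(1)] by simp
qed

lemma toric_open_toric_embedding:
  assumes "openin TZ U"
  shows "toric_open k normal_fan {C \<in> toric_points k normal_fan. toric_embedding C \<in> U}"
  unfolding toric_open_def using openin_point_preimage[OF _ assms] by (auto simp: chart_preimage_toric_embedding)

section \<open>The two mutually inverse morphisms\<close>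

lemma morphism_toric_embedding: "morphism X (closed_subspace N Z) toric_embedding"
  unfolding morphism_def
proof (intro conjI allI impI)
  show "continuous_map (zariski X) (zariski (closed_subspace N Z)) toric_embedding"
    unfolding continuous_map_def
    using toric_open_toric_embedding
    by (auto simp: closed_subspace_def topspace_X topspace_TZ openin_toric_variety toric_points_eq
        toric_embedding_class simp del: topspace_subtopology)
  fix V f assume V: "regular (closed_subspace N Z) V f"
  then have VZ: "openin TZ V"
    and loc: "\<And>p. p \<in> V \<Longrightarrow> \<exists>U. openin TZ U \<and> p \<in> U \<and> U \<subseteq> V \<and> proj_fraction N U f"
    by (simp_all add: closed_subspace_def sheaf_of_def)
  let ?V = "{C \<in> topspace (zariski X). toric_embedding C \<in> V}"
  have "sheaf_of (chart_zariski k \<sigma>) (chart_fraction k \<sigma>) (chart_preimage k normal_fan \<sigma> ?V)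
      (\<lambda>\<gamma>. (f \<circ> toric_embedding) (gluing k normal_fan `` {(\<sigma>, \<gamma>)}))" if \<sigma>: "\<sigma> \<in> normal_fan" for \<sigma>
    unfolding sheaf_of_def topspace_X chart_preimage_toric_embedding[OF \<sigma>]
  proof (intro conjI ballI openin_point_preimage[OF \<sigma> VZ])
    obtain w S where w: "w \<in> W" "\<sigma> \<subseteq> full w" using \<sigma> by (rule normal_fanE)
    fix \<gamma> assume "\<gamma> \<in> {\<gamma> \<in> toric_chart k \<sigma>. point \<sigma> \<gamma> \<in> V}"
    then have \<gamma>: "\<gamma> \<in> toric_chart k \<sigma>" "point \<sigma> \<gamma> \<in> V" by auto
    obtain U where U: "openin TZ U" "point \<sigma> \<gamma> \<in> U" "U \<subseteq> V" "proj_fraction N U f"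
      using loc[OF \<gamma>(2)] by blast
    obtain d F G where FG: "hom_poly N d F" "hom_poly N d G"
      "\<And>p v. p \<in> U \<Longrightarrow> v \<in> p \<Longrightarrow> G v \<noteq> 0 \<and> f p = F v / G v"
      using U(4) unfolding proj_fraction_def by blast
    obtain F' where F': "F' \<in> coordinate_ring k \<sigma>"
      "\<And>\<gamma>. \<gamma> \<in> toric_chart k \<sigma> \<Longrightarrow> F (hom_coords w \<gamma>) = F' \<gamma>"
      using hom_poly_pullback[OF w FG(1)] by blast
    obtain G' where G': "G' \<in> coordinate_ring k \<sigma>"
      "\<And>\<gamma>. \<gamma> \<in> toric_chart k \<sigma> \<Longrightarrow> G (hom_coords w \<gamma>) = G' \<gamma>"
      using hom_poly_pullback[OF w FG(2)] by blast
    let ?U = "{\<gamma> \<in> toric_chart k \<sigma>. point \<sigma> \<gamma> \<in> U}"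
    have "G' \<gamma> \<noteq> 0 \<and> (f \<circ> toric_embedding) (gluing k normal_fan `` {(\<sigma>, \<gamma>)}) = F' \<gamma> / G' \<gamma>"
      if "\<gamma> \<in> ?U" for \<gamma>
    proof -
      have \<gamma>: "\<gamma> \<in> toric_chart k \<sigma>" "point \<sigma> \<gamma> \<in> U" using that by auto
      have "(f \<circ> toric_embedding) (gluing k normal_fan `` {(\<sigma>, \<gamma>)}) = f (point \<sigma> \<gamma>)"
        using gluing_class[OF \<sigma> \<gamma>(1)] point_image_variety[OF \<sigma> \<gamma>(1)] by (simp add: toric_embedding_class)
      then show ?thesis
        using FG(3)[OF \<gamma>(2), of "hom_coords w \<gamma>"] point_eq[OF w \<gamma>(1)] line_self
          F'(2)[OF \<gamma>(1)] G'(2)[OF \<gamma>(1)] by simp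
    qed
    then have "chart_fraction k \<sigma> ?U (\<lambda>\<gamma>. (f \<circ> toric_embedding) (gluing k normal_fan `` {(\<sigma>, \<gamma>)}))"
      unfolding chart_fraction_def using F'(1) G'(1) by blast
    then show "\<exists>U. openin (chart_zariski k \<sigma>) U \<and> \<gamma> \<in> U \<and>
        U \<subseteq> {\<gamma> \<in> toric_chart k \<sigma>. point \<sigma> \<gamma> \<in> V} \<and>
        chart_fraction k \<sigma> U (\<lambda>\<gamma>. (f \<circ> toric_embedding) (gluing k normal_fan `` {(\<sigma>, \<gamma>)}))"
      using openin_point_preimage[OF \<sigma> U(1)] \<gamma> U(2,3) by (intro exI[of _ ?U]) auto
  qed
  moreover have "toric_open k normal_fan ?V"
    unfolding topspace_X by (rule toric_open_toric_embedding[OF VZ])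
  ultimately show "regular X ?V (f \<circ> toric_embedding)" by (simp add: toric_variety_def)
qed

lemma chart_class_inverse_chart:
  assumes "w \<in> W" "p \<in> chart_locus w"
  shows "gluing k normal_fan `` {(full w, inverse_chart w p)} = chart_class p"
  using assms by (simp add: gluing_class full_normal_fan inverse_chart_chart point_inverse_chart)

text \<open>Openness is local: on \<open>chart_locus w\<close> the set is the preimage, under the
  inverse chart, of the open set that \<open>V\<close> cuts out in the chart.\<close>

lemma openin_chart_class:
  assumes V: "toric_open k normal_fan V"
  shows "openin TZ {p \<in> Z. chart_class p \<in> V}"
proof (subst openin_subopen, intro ballI)
  fix p assume p: "p \<in> {p \<in> Z. chart_class p \<in> V}"
  then obtain w where w: "w \<in> W" "p \<in> chart_locus w" using chart_locus_cover by blast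
  let ?U = "chart_preimage k normal_fan (full w) V"
  have U: "openin (chart_zariski k (full w)) ?U"
    using V full_normal_fan[OF w(1)] by (simp add: toric_open_def)
  have "inverse_chart w q \<in> ?U \<longleftrightarrow> chart_class q \<in> V" if "q \<in> chart_locus w" for q
    using that w(1) by (simp add: chart_preimage_def chart_class_inverse_chart inverse_chart_chart)
  then have "{q \<in> chart_locus w. inverse_chart w q \<in> ?U} \<subseteq> {p \<in> Z. chart_class p \<in> V}"
    "p \<in> {q \<in> chart_locus w. inverse_chart w q \<in> ?U}"
    using p w by (auto simp: chart_locus_def)
  then show "\<exists>T. openin TZ T \<and> p \<in> T \<and> T \<subseteq> {p \<in> Z. chart_class p \<in> V}"
    using openin_inverse_chart[OF w(1) U] by blast
qed

lemma morphism_chart_class: "morphism (closed_subspace N Z) X chart_class"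
  unfolding morphism_def
proof (intro conjI allI impI)
  show "continuous_map (zariski (closed_subspace N Z)) (zariski X) chart_class"
    unfolding continuous_map_def
    using openin_chart_class
    by (auto simp: closed_subspace_def topspace_X topspace_TZ openin_toric_variety toric_points_eq
        simp del: topspace_subtopology)
  fix V f assume "regular X V f"
  then have V: "toric_open k normal_fan V"
    and sh: "\<And>\<sigma>. \<sigma> \<in> normal_fan \<Longrightarrow> sheaf_of (chart_zariski k \<sigma>) (chart_fraction k \<sigma>)
      (chart_preimage k normal_fan \<sigma> V) (\<lambda>\<gamma>. f (gluing k normal_fan `` {(\<sigma>, \<gamma>)}))"
    by (simp_all add: toric_variety_def)
  have top: "topspace (zariski (closed_subspace N Z)) = Z"
    using topspace_TZ by (simp add: closed_subspace_def)
  have "sheaf_of TZ (proj_fraction N) {p \<in> Z. chart_class p \<in> V} (f \<circ> chart_class)"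
    unfolding sheaf_of_def
  proof (intro conjI ballI openin_chart_class[OF V])
    fix p assume p: "p \<in> {p \<in> Z. chart_class p \<in> V}"
    then obtain w where w: "w \<in> W" "p \<in> chart_locus w" using chart_locus_cover by blast
    have "inverse_chart w p \<in> chart_preimage k normal_fan (full w) V"
      using p w by (simp add: chart_preimage_def chart_class_inverse_chart inverse_chart_chart)
    then obtain U where U: "openin (chart_zariski k (full w)) U" "inverse_chart w p \<in> U"
      "U \<subseteq> chart_preimage k normal_fan (full w) V"
      "chart_fraction k (full w) U (\<lambda>\<gamma>. f (gluing k normal_fan `` {(full w, \<gamma>)}))"
      using sh[OF full_normal_fan[OF w(1)]] unfolding sheaf_of_def by blast
    obtain F G where FG: "F \<in> coordinate_ring k (full w)" "G \<in> coordinate_ring k (full w)"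
      "\<And>\<gamma>. \<gamma> \<in> U \<Longrightarrow> G \<gamma> \<noteq> 0 \<and> f (gluing k normal_fan `` {(full w, \<gamma>)}) = F \<gamma> / G \<gamma>"
      using U(4) unfolding chart_fraction_def by blast
    obtain DF where DF: "\<And>D. DF \<le> D \<Longrightarrow> \<exists>H. hom_poly N D H \<and> (\<forall>v. coord v (vertex w) \<noteq> 0 \<longrightarrow>
        F (affine_coords w v) = H v / coord v (vertex w) ^ D)"
      using coordinate_ring_homogenize[OF w(1) FG(1)] by blast
    obtain DG where DG: "\<And>D. DG \<le> D \<Longrightarrow> \<exists>H. hom_poly N D H \<and> (\<forall>v. coord v (vertex w) \<noteq> 0 \<longrightarrow>
        G (affine_coords w v) = H v / coord v (vertex w) ^ D)"
      using coordinate_ring_homogenize[OF w(1) FG(2)] by blast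
    \<comment> \<open>With one degree for numerator and denominator the powers of the vertex
      coordinate cancel, and a fraction of forms of equal degree remains.\<close>
    define D where "D = max DF DG"
    obtain HF where HF: "hom_poly N D HF" "\<And>v. coord v (vertex w) \<noteq> 0 \<Longrightarrow>
        F (affine_coords w v) = HF v / coord v (vertex w) ^ D"
      using DF[of D] by (auto simp: D_def)
    obtain HG where HG: "hom_poly N D HG" "\<And>v. coord v (vertex w) \<noteq> 0 \<Longrightarrow>
        G (affine_coords w v) = HG v / coord v (vertex w) ^ D"
      using DG[of D] by (auto simp: D_def)
    let ?U = "{q \<in> chart_locus w. inverse_chart w q \<in> U}"
    have "HG v \<noteq> 0 \<and> (f \<circ> chart_class) q = HF v / HG v" if q: "q \<in> ?U" and v: "v \<in> q" for q v
    proof -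
      have qZ: "q \<in> Z" and nz: "coord v (vertex w) \<noteq> 0"
        using q v by (auto simp: chart_locus_def)
      have "G (inverse_chart w q) \<noteq> 0" "(f \<circ> chart_class) q = F (inverse_chart w q) / G (inverse_chart w q)"
        using FG(3)[of "inverse_chart w q"] q chart_class_inverse_chart[OF w(1)] by auto
      then show ?thesis
        using nz by (simp add: inverse_chart_eq[OF w(1) qZ v] HF(2)[OF nz] HG(2)[OF nz])
    qed
    then have "proj_fraction N ?U (f \<circ> chart_class)"
      unfolding proj_fraction_def using HF(1) HG(1) by blast
    moreover have "?U \<subseteq> {p \<in> Z. chart_class p \<in> V}"
      using U(3) chart_class_inverse_chart[OF w(1)] by (auto simp: chart_locus_def chart_preimage_def)
    ultimately show "\<exists>U. openin TZ U \<and> p \<in> U \<and> U \<subseteq> {p \<in> Z. chart_class p \<in> V} \<and>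
        proj_fraction N U (f \<circ> chart_class)"
      using openin_inverse_chart[OF w(1) U(1)] w U(2) by (intro exI[of _ ?U]) auto
  qed
  then show "regular (closed_subspace N Z) {p \<in> topspace (zariski (closed_subspace N Z)). chart_class p \<in> V}
      (f \<circ> chart_class)"
    unfolding top by (simp add: closed_subspace_def)
qed

theorem projective_normal_fan: "projective_fan k normal_fan"
  unfolding projective_fan_def projective_variety_def isomorphic_def
proof (intro exI conjI ballI)
  show "closedin (proj_zariski N) Z" by (rule closedin_image_variety)
  show "morphism X (closed_subspace N Z) toric_embedding" by (rule morphism_toric_embedding)
  show "morphism (closed_subspace N Z) X chart_class" by (rule morphism_chart_class)
  show "chart_class (toric_embedding C) = C" if "C \<in> topspace (zariski X)" for C
    using that by (auto simp: topspace_X toric_points_eq toric_embedding_class)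
  show "toric_embedding (chart_class p) = p" if "p \<in> topspace (zariski (closed_subspace N Z))" for p
    using that topspace_TZ by (simp add: closed_subspace_def toric_embedding_class)
qed

end

section \<open>Bott towers\<close>

text \<open>What is kept of the Bott matrix: both families of rays are triangular with diagonal
  entries 1 and -1, while the entries of \<open>a i 1\<close> beyond the diagonal are arbitrary
  integers.\<close>

locale bott_rays =
  fixes k :: nat and a :: "nat \<Rightarrow> nat \<Rightarrow> int vec"
  assumes a_carrier [simp]: "i < k \<Longrightarrow> a i e \<in> carrier_vec k"
    and a_unit: "i < k \<Longrightarrow> a i 0 = unit_vec k i"
    and a_below: "\<lbrakk>i < k; j < i\<rbrakk> \<Longrightarrow> a i 1 $ j = 0"
    and a_diag: "i < k \<Longrightarrow> a i 1 $ i = - 1"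
begin

section \<open>Triangular integral systems\<close>

definition tail :: "nat \<Rightarrow> int vec \<Rightarrow> int" where
  "tail i m = (\<Sum>j\<in>{i<..<k}. m $ j * a i 1 $ j)"

lemma prod_a0: "\<lbrakk>m \<in> carrier_vec k; i < k\<rbrakk> \<Longrightarrow> m \<bullet> a i 0 = m $ i"
  by (simp add: a_unit)

lemma prod_a1:
  assumes "i < k"
  shows "m \<bullet> a i 1 = tail i m - m $ i"
proof -
  have "{..<k} = {..<i} \<union> {i} \<union> {i<..<k}" using assms by auto
  then have "m \<bullet> a i 1 = (\<Sum>j\<in>{..<i} \<union> {i} \<union> {i<..<k}. m $ j * a i 1 $ j)"
    using assms by (simp only: scalar_prod_carrier[OF a_carrier[OF assms]])
  also have "\<dots> = (\<Sum>j\<in>{..<i}. m $ j * a i 1 $ j) + m $ i * a i 1 $ i + tail i m"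
    by (subst sum.union_disjoint; (subst sum.union_disjoint)?) (auto simp: tail_def)
  also have "(\<Sum>j\<in>{..<i}. m $ j * a i 1 $ j) = 0"
    using assms by (intro sum.neutral) (simp add: a_below del: One_nat_def)
  finally show ?thesis using assms a_diag by simp
qed

lemma tail_cong: "(\<And>j. \<lbrakk>i < j; j < k\<rbrakk> \<Longrightarrow> m $ j = m' $ j) \<Longrightarrow> tail i m = tail i m'"
  unfolding tail_def by (intro sum.cong) auto

abbreviation W :: "(nat \<Rightarrow> nat) set" where
  "W \<equiv> {..<k} \<rightarrow> {0, 1}"

abbreviation ray :: "(nat \<Rightarrow> nat) \<Rightarrow> nat \<Rightarrow> int vec" where
  "ray w i \<equiv> a i (w i)"

lemma W_cases: "\<lbrakk>w \<in> W; i < k\<rbrakk> \<Longrightarrow> w i = 0 \<or> w i = 1"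
  by auto

text \<open>Back substitution from the last index: the pairing with \<open>ray w i\<close> involves
  only coordinates from i on, with coefficient 1 or -1 at i, so the solution is integral.\<close>

lemma triangular_exists:
  assumes w: "w \<in> W"
  shows "\<exists>x\<in>carrier_vec k. \<forall>i<k. x \<bullet> ray w i = s i"
proof -
  have "\<exists>x\<in>carrier_vec k. \<forall>i<k. k - l \<le> i \<longrightarrow> x \<bullet> ray w i = s i" if "l \<le> k" for l
    using that
  proof (induction l)
    case 0
    show ?case by (intro bexI[of _ "0\<^sub>v k"]) auto
  next
    case (Suc l)
    then obtain x where x: "x \<in> carrier_vec k" "\<And>i. \<lbrakk>i < k; k - l \<le> i\<rbrakk> \<Longrightarrow> x \<bullet> ray w i = s i"
      by auto
    let ?i = "k - Suc l"
    have i: "?i < k" using Suc by simp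
    \<comment> \<open>Solves the equation of index \<open>?i\<close>: its left side is t for the ray
      0 and \<open>tail ?i x - t\<close> for the ray 1.\<close>
    define t where "t = (if w ?i = 0 then s ?i else tail ?i x - s ?i)"
    define y where "y = vec k (\<lambda>j. if j = ?i then t else x $ j)"
    have y: "y \<in> carrier_vec k" "y $ ?i = t" "\<And>j. \<lbrakk>?i < j; j < k\<rbrakk> \<Longrightarrow> y $ j = x $ j"
      using i by (auto simp: y_def)
    have "y \<bullet> ray w j = s j" if j: "j < k" "?i \<le> j" for j
    proof (cases "j = ?i")
      case True
      have "tail ?i y = tail ?i x" using y(3) by (intro tail_cong) auto
      then show ?thesis
        using W_cases[OF w i] y i by (auto simp: True prod_a0 prod_a1 t_def simp del: One_nat_def)
    next
      case False
      then have "?i < j" "k - l \<le> j" using j by auto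
      then have "y \<bullet> ray w j = x \<bullet> ray w j"
        using W_cases[OF w j(1)] y x(1) j tail_cong[of j y x]
        by (auto simp: prod_a0 prod_a1 simp del: One_nat_def)
      then show ?thesis using x(2)[OF j(1) \<open>k - l \<le> j\<close>] by simp
    qed
    then show ?case using y(1) by blast
  qed
  from this[of k] show ?thesis by simp
qed

text \<open>Only a final segment of the equations is assumed: l = 0 gives uniqueness of solutions,
  \<open>l = Suc i\<close> shows that \<open>edge w i\<close> has no entries beyond i.\<close>

lemma triangular_zero:
  assumes w: "w \<in> W" and x: "x \<in> carrier_vec k"
    and z: "\<And>i. \<lbrakk>l \<le> i; i < k\<rbrakk> \<Longrightarrow> x \<bullet> ray w i = 0" and i: "l \<le> i" "i < k"
  shows "x $ i = 0"
  using i
proof (induction "k - i" arbitrary: i rule: less_induct)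
  case less
  have "x $ j = 0" if "i < j" "j < k" for j
    using less.hyps[of j] less.prems that by auto
  then have "tail i x = 0" by (simp add: tail_def)
  then show ?case
    using z[OF less.prems] W_cases[OF w less.prems(2)] x less.prems(2)
    by (auto simp: prod_a0 prod_a1 simp del: One_nat_def)
qed

lemma triangular_unique:
  assumes w: "w \<in> W" and x: "x \<in> carrier_vec k" "y \<in> carrier_vec k"
    and eq: "\<And>i. i < k \<Longrightarrow> x \<bullet> ray w i = y \<bullet> ray w i"
  shows "x = y"
proof (rule eq_vecI)
  fix j assume "j < dim_vec y"
  then have j: "j < k" using x by simp
  have "(x - y) $ j = 0"
    using x eq j by (intro triangular_zero[OF w, of _ 0]) (auto simp: minus_scalar_prod_distrib[of _ k])
  then show "x $ j = y $ j" using x j by simp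
qed (use x in simp)

definition solution :: "(nat \<Rightarrow> nat) \<Rightarrow> (nat \<Rightarrow> int) \<Rightarrow> int vec" where
  "solution w s = (SOME x. x \<in> carrier_vec k \<and> (\<forall>i<k. x \<bullet> ray w i = s i))"

lemma solution:
  assumes "w \<in> W"
  shows "solution w s \<in> carrier_vec k" "i < k \<Longrightarrow> solution w s \<bullet> ray w i = s i"
proof -
  have "\<exists>x. x \<in> carrier_vec k \<and> (\<forall>i<k. x \<bullet> ray w i = s i)"
    using triangular_exists[OF assms] by blast
  from someI_ex[OF this] show "solution w s \<in> carrier_vec k" "i < k \<Longrightarrow> solution w s \<bullet> ray w i = s i"
    unfolding solution_def by auto
qed

definition edge :: "(nat \<Rightarrow> nat) \<Rightarrow> nat \<Rightarrow> int vec" where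
  "edge w i = solution w (\<lambda>j. if i = j then 1 else 0)"

lemma edge:
  assumes "w \<in> W"
  shows "edge w i \<in> carrier_vec k" "j < k \<Longrightarrow> edge w i \<bullet> ray w j = (if i = j then 1 else 0)"
  using solution[OF assms] by (simp_all add: edge_def)

text \<open>A one-sided inverse matrix is two-sided; here this follows from uniqueness, as the
  vector of these sums and \<open>unit_vec k l\<close> have the same pairing with every ray.\<close>

lemma ray_edge_dual:
  assumes w: "w \<in> W" and "j < k" "l < k"
  shows "(\<Sum>i<k. edge w i $ j * ray w i $ l) = (if j = l then 1 else 0)"
proof -
  let ?y = "vec k (\<lambda>j. \<Sum>i<k. edge w i $ j * ray w i $ l)"
  have "?y = unit_vec k l"
  proof (rule triangular_unique[OF w])
    fix i' assume i': "i' < k"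
    have "?y \<bullet> ray w i' = (\<Sum>j<k. \<Sum>i<k. ray w i $ l * (edge w i $ j * ray w i' $ j))"
      using i' by (simp add: scalar_prod_carrier[OF a_carrier] sum_distrib_left mult_ac)
    also have "\<dots> = (\<Sum>i<k. ray w i $ l * (edge w i \<bullet> ray w i'))"
      using i' by (subst sum.swap) (simp add: scalar_prod_carrier[OF a_carrier] sum_distrib_left)
    also have "\<dots> = (\<Sum>i<k. if i = i' then ray w i $ l else 0)"
      using i' by (intro sum.cong refl) (simp add: edge[OF w])
    also have "\<dots> = unit_vec k l \<bullet> ray w i'"
      using i' assms by simp
    finally show "?y \<bullet> ray w i' = unit_vec k l \<bullet> ray w i'" .
  qed auto
  then have "?y $ j = unit_vec k l $ j" by simp
  then show ?thesis using assms by simp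
qed

section \<open>The combinatorial cube\<close>

text \<open>
  The constants \<open>height i\<close> grow so fast with decreasing \<open>i\<close> that every fibre
  \<open>0 \<le> m\<^sub>i \<le> height i + tail i m\<close> of the polytope over its last coordinates has length
  at least \<open>1\<close>; \<open>growth ^ (k - i)\<close> bounds the \<open>i\<close>-th coordinate.
\<close>

definition weight :: int where
  "weight = (\<Sum>i<k. \<Sum>j<k. \<bar>a i 1 $ j\<bar>)"

text \<open>The base is dictated by the recursion in \<open>coordinate_bound\<close>: coordinate j
  is at most \<open>1 + 2 * (weight * growth ^ (k - Suc j))\<close>, which must not exceed
  \<open>growth ^ (k - j)\<close>.\<close>

definition growth :: int where
  "growth = 1 + 2 * weight"

definition height :: "nat \<Rightarrow> int" where
  "height i = 1 + weight * growth ^ (k - Suc i)"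

definition valid :: "int vec \<Rightarrow> nat \<Rightarrow> bool" where
  "valid m i \<longleftrightarrow> 0 \<le> m $ i \<and> - height i \<le> m \<bullet> a i 1"

definition P :: "int vec set" where
  "P = {m \<in> carrier_vec k. \<forall>i<k. valid m i}"

lemma weight_nonneg: "0 \<le> weight"
  unfolding weight_def by (intro sum_nonneg) auto

lemma growth_ge_1: "1 \<le> growth"
  using weight_nonneg by (simp add: growth_def)

lemma tail_bound:
  assumes i: "i < k" and m: "\<And>j. \<lbrakk>i < j; j < k\<rbrakk> \<Longrightarrow> 0 \<le> m $ j \<and> m $ j \<le> growth ^ (k - j)"
  shows "\<bar>tail i m\<bar> \<le> weight * growth ^ (k - Suc i)"
proof -
  have "\<bar>tail i m\<bar> \<le> (\<Sum>j\<in>{i<..<k}. \<bar>m $ j * a i 1 $ j\<bar>)"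
    unfolding tail_def by (rule sum_abs)
  also have "\<dots> \<le> (\<Sum>j\<in>{i<..<k}. growth ^ (k - Suc i) * \<bar>a i 1 $ j\<bar>)"
  proof (rule sum_mono)
    fix j assume j: "j \<in> {i<..<k}"
    have "growth ^ (k - j) \<le> growth ^ (k - Suc i)"
      using j by (intro power_increasing growth_ge_1) auto
    then have "\<bar>m $ j\<bar> \<le> growth ^ (k - Suc i)" using m[of j] j by auto
    then show "\<bar>m $ j * a i 1 $ j\<bar> \<le> growth ^ (k - Suc i) * \<bar>a i 1 $ j\<bar>"
      by (simp add: abs_mult mult_right_mono)
  qed
  also have "\<dots> = growth ^ (k - Suc i) * (\<Sum>j\<in>{i<..<k}. \<bar>a i 1 $ j\<bar>)"
    by (simp add: sum_distrib_left)
  also have "\<dots> \<le> growth ^ (k - Suc i) * weight"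
  proof (rule mult_left_mono)
    have "(\<Sum>j\<in>{i<..<k}. \<bar>a i 1 $ j\<bar>) \<le> (\<Sum>j<k. \<bar>a i 1 $ j\<bar>)"
      by (rule sum_mono2) auto
    also have "\<dots> \<le> weight"
      unfolding weight_def using i
      by (intro member_le_sum[of i "{..<k}" "\<lambda>i. \<Sum>j<k. \<bar>a i 1 $ j\<bar>"] sum_nonneg) auto
    finally show "(\<Sum>j\<in>{i<..<k}. \<bar>a i 1 $ j\<bar>) \<le> weight" .
  qed (use growth_ge_1 in simp)
  finally show ?thesis by (simp add: mult.commute)
qed

lemma coordinate_bound:
  assumes "j < k" "\<And>l. \<lbrakk>j \<le> l; l < k\<rbrakk> \<Longrightarrow> valid m l"
  shows "m $ j \<le> growth ^ (k - j)"
  using assms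
proof (induction "k - j" arbitrary: j rule: less_induct)
  case less
  have "\<bar>tail j m\<bar> \<le> weight * growth ^ (k - Suc j)"
  proof (rule tail_bound[OF less.prems(1)])
    fix l assume l: "j < l" "l < k"
    have "m $ l \<le> growth ^ (k - l)" using l less.prems by (intro less.hyps) auto
    then show "0 \<le> m $ l \<and> m $ l \<le> growth ^ (k - l)"
      using less.prems(2)[of l] l by (simp add: valid_def)
  qed
  moreover have "m $ j \<le> height j + tail j m"
    using less.prems(2)[of j] less.prems(1) by (simp add: valid_def prod_a1 del: One_nat_def)
  ultimately have "m $ j \<le> 1 + 2 * (weight * growth ^ (k - Suc j))"
    by (simp add: height_def)
  also have "\<dots> \<le> growth ^ (k - Suc j) + 2 * (weight * growth ^ (k - Suc j))"
    using one_le_power[OF growth_ge_1] by simp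
  also have "\<dots> = growth ^ Suc (k - Suc j)" by (simp add: growth_def algebra_simps)
  also have "Suc (k - Suc j) = k - j" using less.prems(1) by simp
  finally show ?case .
qed

text \<open>Only the inequalities of later indices enter, so validity can be established from the
  last index downwards. They bound the tail in absolute value by
  \<open>height i - 1\<close>.\<close>

lemma fibre_length:
  assumes "i < k" "\<And>j. \<lbrakk>i < j; j < k\<rbrakk> \<Longrightarrow> valid m j"
  shows "1 \<le> height i + tail i m"
proof -
  have "\<bar>tail i m\<bar> \<le> weight * growth ^ (k - Suc i)"
    using assms by (intro tail_bound conjI coordinate_bound) (auto simp: valid_def)
  then show ?thesis by (simp add: height_def)
qed

text \<open>The sum m \<bullet> \<open>ray w j\<close> + \<open>int (w j) * height j\<close> is the
  lattice distance from the facet selected by w. If it is 0 or 1, the opposite inequality follows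
  since the fibre has length at least 1. Vertices have distance 0 throughout, and an edge vector
  raises one distance to 1.\<close>

lemma P_memI:
  assumes w: "w \<in> W" and m: "m \<in> carrier_vec k"
    and v: "\<And>j. j < k \<Longrightarrow> m \<bullet> ray w j + int (w j) * height j \<in> {0, 1} \<or> valid m j"
  shows "m \<in> P"
proof -
  have "valid m j" if "j < k" for j
    using that
  proof (induction "k - j" arbitrary: j rule: less_induct)
    case less
    have "valid m l" if "j < l" "l < k" for l
      using that less.prems by (intro less.hyps) auto
    then have f: "1 \<le> height j + tail j m" by (rule fibre_length[OF less.prems])
    from v[OF less.prems] show ?case
      using W_cases[OF w less.prems] f less.prems m
      by (auto simp: valid_def prod_a0 prod_a1 simp del: One_nat_def)
  qed
  then show ?thesis using m by (simp add: P_def)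
qed

definition vertex :: "(nat \<Rightarrow> nat) \<Rightarrow> int vec" where
  "vertex w = solution w (\<lambda>i. - (int (w i) * height i))"

lemma vertex:
  assumes "w \<in> W"
  shows "vertex w \<in> carrier_vec k" "j < k \<Longrightarrow> vertex w \<bullet> ray w j = - (int (w j) * height j)"
  using solution[OF assms] by (simp_all add: vertex_def)

lemma finite_P: "finite P"
proof (rule finite_subset)
  show "P \<subseteq> vec k ` ({..<k} \<rightarrow>\<^sub>E {0..growth ^ k})"
  proof
    fix m assume m: "m \<in> P"
    then have "m = vec k (restrict (\<lambda>i. m $ i) {..<k})" by (intro eq_vecI) (auto simp: P_def)
    moreover have "m $ i \<le> growth ^ k" if "i < k" for i
    proof -
      have "m $ i \<le> growth ^ (k - i)"
        using m that by (intro coordinate_bound) (auto simp: P_def)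
      also have "\<dots> \<le> growth ^ k" by (intro power_increasing growth_ge_1) auto
      finally show ?thesis .
    qed
    then have "restrict (\<lambda>i. m $ i) {..<k} \<in> {..<k} \<rightarrow>\<^sub>E {0..growth ^ k}"
      using m by (simp add: restrict_PiE_iff P_def valid_def)
    ultimately show "m \<in> vec k ` ({..<k} \<rightarrow>\<^sub>E {0..growth ^ k})" by (rule image_eqI)
  qed
qed (intro finite_imageI finite_PiE; simp)

text \<open>The direction is \<open>edge w i\<close> for the first index i at which m is on neither
  facet: smaller indices stay on their facets, later coordinates do not change, and coordinate i
  moves by 1 between strict integral bounds.\<close>

lemma non_vertex_P:
  assumes m: "m \<in> P" and nv: "m \<notin> vertex ` W"
  shows "\<exists>x\<in>carrier_vec k. x \<noteq> 0\<^sub>v k \<and> m + x \<in> P \<and> m - x \<in> P"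
proof -
  have mk: "m \<in> carrier_vec k" and mv: "\<And>i. i < k \<Longrightarrow> valid m i" using m by (auto simp: P_def)
  \<comment> \<open>The lower facet is selected whenever m lies on it, so an index with slack is off
    both facets.\<close>
  define w where "w i = (if m $ i = 0 then 0 else 1 :: nat)" for i
  have w: "w \<in> W" by (auto simp: w_def)
  define slack where "slack i \<longleftrightarrow> i < k \<and> m \<bullet> ray w i \<noteq> - (int (w i) * height i)" for i
  have "\<exists>i. slack i"
  proof (rule ccontr)
    assume "\<not> (\<exists>i. slack i)"
    then have "m = vertex w"
      using mk vertex[OF w] by (intro triangular_unique[OF w]) (auto simp: slack_def)
    then show False using nv w by blast
  qed
  then obtain i where i: "slack i" "\<And>j. slack j \<Longrightarrow> i \<le> j"
    using LeastI_ex[of slack] Least_le[of slack] by blast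
  have ik: "i < k" using i(1) by (simp add: slack_def)
  have wi: "w i = 1" using i(1) mk by (auto simp: slack_def w_def prod_a0)
  have mi: "0 < m $ i" "- height i < m \<bullet> a i 1"
  proof -
    have "m $ i \<noteq> 0" using wi unfolding w_def by (rule contrapos_pn) simp
    moreover have "m \<bullet> a i 1 \<noteq> - height i" using i(1) unfolding slack_def wi by simp
    ultimately show "0 < m $ i" "- height i < m \<bullet> a i 1"
      using mv[OF ik] unfolding valid_def by linarith+
  qed
  define x where "x = edge w i"
  have xk: "x \<in> carrier_vec k" using edge[OF w] by (simp add: x_def)
  have x0: "x $ j = 0" if "i < j" "j < k" for j
    using that edge[OF w] xk unfolding x_def by (intro triangular_zero[OF w, of _ "Suc i"]) auto
  have "tail i x = 0" using x0 by (simp add: tail_def)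
  then have xi: "x $ i = -1"
    using edge(2)[OF w ik, of i] ik by (simp add: x_def[symmetric] wi prod_a1 del: One_nat_def)
  have move: "m + y \<in> P"
    if y: "y \<in> carrier_vec k" "y $ i \<in> {1, -1}" "\<And>j. \<lbrakk>i < j; j < k\<rbrakk> \<Longrightarrow> y $ j = 0"
      "\<And>j. j < i \<Longrightarrow> y \<bullet> ray w j = 0" for y
  proof (rule P_memI[OF w])
    show "m + y \<in> carrier_vec k" using mk y by simp
    fix j assume j: "j < k"
    have add: "(m + y) \<bullet> a j e = m \<bullet> a j e + y \<bullet> a j e" for e
      using mk y j by (intro add_scalar_prod_distrib[of _ k]) auto
    consider "j < i" | "j = i" | "i < j" by linarith
    then show "(m + y) \<bullet> ray w j + int (w j) * height j \<in> {0, 1} \<or> valid (m + y) j"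
    proof cases
      case 1
      then have "\<not> slack j" using i(2) by fastforce
      then show ?thesis using 1 j y by (simp add: add slack_def)
    next
      case 2
      have "tail i y = 0" using y(3) by (simp add: tail_def)
      then have "y \<bullet> a i 1 = - (y $ i)" using prod_a1[OF ik] by simp
      then have "valid (m + y) i"
        using mi y(1,2) mk ik add unfolding valid_def 2 by auto
      then show ?thesis using 2 by simp
    next
      case 3
      have "tail j y = 0" using y(3) 3 by (simp add: tail_def)
      then have "y \<bullet> a j 1 = 0" using prod_a1[OF j] y(3)[OF 3 j] by simp
      then have "valid (m + y) j"
        using mv[OF j] y(1) y(3)[OF 3 j] mk j add unfolding valid_def by auto
      then show ?thesis by simp
    qed
  qed
  have xr: "x \<bullet> ray w j = 0" if "j < i" for j
    using edge(2)[OF w, of j i] that ik by (simp add: x_def)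
  have "m + x \<in> P" using xk xi x0 xr by (intro move) auto
  moreover have "m + (- x) \<in> P"
  proof (rule move)
    show "(- x) \<bullet> ray w j = 0" if "j < i" for j
    proof -
      have "dim_vec (ray w j) = k" using that ik carrier_vecD[OF a_carrier[of j]] by simp
      then have "(- x) \<bullet> ray w j = - (x \<bullet> ray w j)"
        using xk by (simp add: scalar_prod_def sum_negf)
      then show ?thesis using xr[OF that] by simp
    qed
  qed (use xk xi x0 ik in auto)
  moreover have "m + (- x) = m - x" using mk xk by (intro eq_vecI) auto
  moreover have "x \<noteq> 0\<^sub>v k" using xi ik by auto
  ultimately show ?thesis using xk by metis
qed

sublocale smooth_polytope k W ray edge vertex P
proof
  show "edge w i \<bullet> ray w j = (if i = j then 1 else 0)" if "w \<in> W" "i < k" "j < k" for w i j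
    using edge that by simp
  show "(\<Sum>i<k. edge w i $ j * ray w i $ l) = (if j = l then 1 else 0)"
    if "w \<in> W" "j < k" "l < k" for w j l
    using that by (rule ray_edge_dual)
  show "W \<noteq> {}" by (auto simp: Pi_eq_empty)
  show "vertex w \<in> P" if "w \<in> W" for w
    using vertex[OF that] by (intro P_memI[OF that]) auto
  show "vertex w + edge w i \<in> P" if "w \<in> W" "i < k" for w i
  proof (rule P_memI[OF that(1)])
    show "vertex w + edge w i \<in> carrier_vec k" using vertex[OF that(1)] edge[OF that(1)] by simp
    fix j assume j: "j < k"
    have "(vertex w + edge w i) \<bullet> ray w j = vertex w \<bullet> ray w j + edge w i \<bullet> ray w j"
      using vertex[OF that(1)] edge[OF that(1)] j by (intro add_scalar_prod_distrib[of _ k]) auto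
    then show "(vertex w + edge w i) \<bullet> ray w j + int (w j) * height j \<in> {0, 1} \<or>
        valid (vertex w + edge w i) j"
      using vertex[OF that(1)] edge[OF that(1)] j by simp
  qed
  show "0 \<le> (m - vertex w) \<bullet> ray w i" if "w \<in> W" "i < k" "m \<in> P" for w i m
  proof -
    have mk: "m \<in> carrier_vec k" "valid m i" using that by (auto simp: P_def)
    have "(m - vertex w) \<bullet> ray w i = m \<bullet> ray w i - vertex w \<bullet> ray w i"
      using mk vertex[OF that(1)] that by (intro minus_scalar_prod_distrib[of _ k]) auto
    then show ?thesis
      using vertex(2)[OF that(1,2)] W_cases[OF that(1,2)] mk that(2)
      by (auto simp: valid_def prod_a0)
  qed
  \<comment> \<open>Words are functions with arbitrary values from k on, so \<open>W\<close> is
    infinite, but at most 2k rays occur.\<close>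
  have "(\<lambda>(w, i). ray w i) ` (W \<times> {..<k}) \<subseteq> (\<lambda>(i, e). a i e) ` ({..<k} \<times> {0, 1})"
    by force
  then show "finite ((\<lambda>(w, i). ray w i) ` (W \<times> {..<k}))" by (rule finite_subset) simp
  show "finite P" by (rule finite_P)
  show "\<exists>x\<in>carrier_vec k. x \<noteq> 0\<^sub>v k \<and> m + x \<in> P \<and> m - x \<in> P"
    if "m \<in> P" "m \<notin> vertex ` W" for m
    using that by (rule non_vertex_P)
qed (auto simp: edge P_def)

end

text \<open>Compare row i, column j of \<open>- B * C = 1\<close>: the entries of \<open>C\<close>
  below the diagonal vanish, those of row i of \<open>B\<close> before j vanish by induction, so
  only the summand l = j survives.\<close>

lemma bott_matrix_triangular:
  assumes "i < n" "j \<le> i"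
  shows "bott_matrix n c $$ (i, j) = (if i = j then - 1 else 0)"
  using assms(2)
proof (induction j rule: less_induct)
  case (less j)
  let ?B = "bott_matrix n c" and ?C = "seq_matrix n c"
  have j: "j < n" using less.prems assms(1) by simp
  have dims: "?B \<in> carrier_mat n n" "?C \<in> carrier_mat n n"
    using bott_matrix(1) by (auto simp: seq_matrix_def)
  have "(- ?B * ?C) $$ (i, j) = (\<Sum>l<n. - ?B $$ (i, l) * ?C $$ (l, j))"
    using dims assms(1) j by (simp add: scalar_prod_def lessThan_atLeast0 sum_negf)
  also have "\<dots> = (\<Sum>l<n. if l = j then - ?B $$ (i, j) else 0)"
  proof (intro sum.cong refl)
    fix l assume l: "l \<in> {..<n}"
    consider "l < j" | "l = j" | "j < l" by linarith
    then show "- ?B $$ (i, l) * ?C $$ (l, j) = (if l = j then - ?B $$ (i, j) else 0)"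
      using l j less.IH[of l] less.prems by cases (auto simp: seq_matrix_def)
  qed
  also have "\<dots> = - ?B $$ (i, j)" using j by simp
  finally show ?case using bott_matrix(3)[of n c] assms(1) j by (auto split: if_splits)
qed

lemma bott_rays_bott_ray:
  assumes "k \<le> n"
  shows "bott_rays k (bott_ray n k c)"
proof
  fix i assume i: "i < k"
  then show "bott_ray n k c i 1 $ i = - 1"
    using assms bott_matrix_triangular[of i n i c] by (simp add: bott_ray_def)
qed (auto simp: bott_ray_def)

text \<open>Smoothness and projectivity are notions for fans, so the fan axioms are part of the
  claim.\<close>

theorem proposition3p14:
  fixes c :: "nat \<Rightarrow> nat \<Rightarrow> int" and n k :: nat
  assumes "1 \<le> k" and "k \<le> n"
  shows "fan k (bott_fan n k c) \<and> smooth_fan k (bott_fan n k c) \<and>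
    projective_fan k (bott_fan n k c)"
proof -
  interpret bott_rays k "bott_ray n k c" by (rule bott_rays_bott_ray[OF assms(2)])
  have full: "bott_cone n k c w = full w" for w by (simp add: bott_cone_def cone_def)
  \<comment> \<open>The faces of the maximal cones are the cones spanned by subsets of their
    rays.\<close>
  have "bott_fan n k c = normal_fan"
  proof (intro subset_antisym subsetI)
    fix \<tau> assume "\<tau> \<in> bott_fan n k c"
    then obtain w where w: "w \<in> W" "cone_face k \<tau> (full w)"
      unfolding bott_fan_def full by blast
    then show "\<tau> \<in> normal_fan"
      using cone_face_iff[OF w(1) subset_refl] unfolding normal_fan_def by blast
  next
    fix \<tau> assume "\<tau> \<in> normal_fan"
    then obtain w S where w: "w \<in> W" "S \<subseteq> {..<k}" "\<tau> = cone w S" by (rule normal_fanE)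
    then have "cone_face k \<tau> (full w)" using cone_face_iff[OF w(1) subset_refl] by blast
    then show "\<tau> \<in> bott_fan n k c" using w(1) unfolding bott_fan_def full by blast
  qed
  then show ?thesis using fan_normal_fan smooth_normal_fan projective_normal_fan by simp
qed

end
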